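(* Fix positive integers $L, d_0, d_L$, a finite dataset $D$ of pairs $(x,y)$ with $x\in\mathbb{R}^{d_0}$ and $y\in Y$ for some set $Y$, nonlinearities $\sigma_1,\dots,\sigma_L$, an error function $e$, a regularization parameter $\lambda>0$, an exponent $1\le p<\infty$, and $\Omega\in\{\Omega_{in},\Omega_{out}\}$, all satisfying the standing assumptions in the context. Then the function $$E(\mathbf{d},\mathbf{W})=\frac{1}{|D|}\sum_{(x,y)\in D} e(f(\mathbf{W},x),y)+\Omega(\mathbf{W},\lambda,p),$$ defined over all pairs $(\mathbf{d},\mathbf{W})$ where $\mathbf{d}=(d_1,\dots,d_{L-1})$ ranges over all tuples of positive integers and $\mathbf{W}=(W_1,\dots,W_L)$ with $W_l\in\mathbb{R}^{d_{l-1}\times d_l}$, attains a global minimum (i.e. there exists $(\mathbf{d}^*,\mathbf{W}^* )$ with $E(\mathbf{d}^*,\mathbf{W}^* )\le E(\mathbf{d},\mathbf{W})$ for all admissible $(\mathbf{d},\mathbf{W})$).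
   Context: Network: for dimensions $d_0,\dots,d_L$ and weights $\mathbf{W}=(W_1,\dots,W_L)$, $W_l\in\mathbb{R}^{d_{l-1}\times d_l}$, define for a row vector $x\in\mathbb{R}^{d_0}$: $x_0=x$, $z_l=x_{l-1}W_l$, $x_l=\sigma_l.(z_l)$ ($\sigma_l$ applied elementwise), $f(\mathbf{W},x)=x_L$. The dimensions $d_0,d_L$ are fixed; $d_1,\dots,d_{L-1}$ vary. Regularizers: $\Omega_{in}(\mathbf{W},\lambda,p)=\lambda\sum_{l=1}^L\sum_{j=1}^{d_l}\|(W_l(1,j),\dots,W_l(d_{l-1},j))\|_p$ (penalizing each column, the fan-in of unit $j$ of layer $l$), and $\Omega_{out}(\mathbf{W},\lambda,p)=\lambda\sum_{l=1}^L\sum_{i=1}^{d_{l-1}}\|(W_l(i,1),\dots,W_l(i,d_l))\|_p$ (penalizing each row). Assumptions on each $\sigma_l:\mathbb{R}\to\mathbb{R}$: (i) there is $b_{1,l}:\mathbb{R}_{\ge0}\to\mathbb{R}_{\ge0}$ with $|\sigma_l(s)|\le b_{1,l}(S)|s|$ for all $S\ge0$, $|s|\le S$; (ii) $\sigma_l$ is left- and right-differentiable everywhere; (iii) there is $b_{2,l}:\mathbb{R}_{\ge0}\to\mathbb{R}_{\ge0}$ such that the left and right derivatives satisfy $|\sigma_l^{\leftarrow}(s)|\le b_{2,l}(S)$ and $|\sigma_l^{\rightarrow}(s)|\le b_{2,l}(S)$ for all $S\ge 0$, $|s|\le S$. Assumptions on $e:\mathbb{R}^{d_L}\times Y\to\mathbb{R}$: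 it is nonnegative everywhere; differentiable in its first argument everywhere; and there is $b_3:\mathbb{R}_{\ge0}\to\mathbb{R}_{\ge0}$ such that for all $S\ge0$, $v\in\mathbb{R}^{d_L}$, $y\in Y$: $e(v,y)\le S$ implies $\|\partial e(v,y)/\partial v\|_\infty\le b_3(S)$. *)

theory Defs
  imports "HOL-Analysis.Analysis"
begin

text \<open>Fixed identification of the coordinates {0..<CARD('a)} with the finite index type 'a.
  Input space R^{d_0} is real^'i (d_0 = CARD('i)), output space R^{d_L} is real^'o.\<close>
definition idx :: "nat \<Rightarrow> 'a::finite" where
  "idx = (SOME f. bij_betw f {..<CARD('a)} (UNIV :: 'a set))"

definition idx_inv :: "'a::finite \<Rightarrow> nat" where
  "idx_inv = inv_into {..<CARD('a)} idx"

definition admissible :: "nat \<Rightarrow> nat \<Rightarrow> nat \<Rightarrow> (nat \<Rightarrow> nat) \<Rightarrow> bool" where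
  "admissible L d0 dL d \<longleftrightarrow> d 0 = d0 \<and> d L = dL \<and> (\<forall>l. 0 < l \<and> l < L \<longrightarrow> 0 < d l)"

text \<open>Weights: W l i j is entry (i,j) of W_l (0-based indices, i < d(l-1), j < d l).
  Layer activations x_l as coordinate functions on {..<d l}.\<close>
fun layer :: "(nat \<Rightarrow> real \<Rightarrow> real) \<Rightarrow> (nat \<Rightarrow> nat) \<Rightarrow> (nat \<Rightarrow> nat \<Rightarrow> nat \<Rightarrow> real)
               \<Rightarrow> (nat \<Rightarrow> real) \<Rightarrow> nat \<Rightarrow> (nat \<Rightarrow> real)" where
  "layer \<sigma> d W x0 0 = x0"
| "layer \<sigma> d W x0 (Suc l) =
     (\<lambda>j. \<sigma> (Suc l) (\<Sum>i<d l. layer \<sigma> d W x0 l i * W (Suc l) i j))"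

definition net :: "nat \<Rightarrow> (nat \<Rightarrow> real \<Rightarrow> real) \<Rightarrow> (nat \<Rightarrow> nat) \<Rightarrow> (nat \<Rightarrow> nat \<Rightarrow> nat \<Rightarrow> real)
                   \<Rightarrow> real^'i::finite \<Rightarrow> real^'o::finite" where
  "net L \<sigma> d W x = (\<chi> k. layer \<sigma> d W (\<lambda>j. x $ idx j) L (idx_inv k))"

definition lpnorm :: "real \<Rightarrow> nat \<Rightarrow> (nat \<Rightarrow> real) \<Rightarrow> real" where
  "lpnorm p n v = (\<Sum>i<n. \<bar>v i\<bar> powr p) powr (1 / p)"

definition Omega_in :: "nat \<Rightarrow> (nat \<Rightarrow> nat) \<Rightarrow> (nat \<Rightarrow> nat \<Rightarrow> nat \<Rightarrow> real) \<Rightarrow> real \<Rightarrow> real \<Rightarrow> real" where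
  "Omega_in L d W lam p = lam * (\<Sum>l\<in>{1..L}. \<Sum>j<d l. lpnorm p (d (l - 1)) (\<lambda>i. W l i j))"

definition Omega_out :: "nat \<Rightarrow> (nat \<Rightarrow> nat) \<Rightarrow> (nat \<Rightarrow> nat \<Rightarrow> nat \<Rightarrow> real) \<Rightarrow> real \<Rightarrow> real \<Rightarrow> real" where
  "Omega_out L d W lam p = lam * (\<Sum>l\<in>{1..L}. \<Sum>i<d (l - 1). lpnorm p (d l) (\<lambda>j. W l i j))"

definition energy :: "nat \<Rightarrow> (nat \<Rightarrow> real \<Rightarrow> real) \<Rightarrow> (real^'o::finite \<Rightarrow> 'y \<Rightarrow> real)
     \<Rightarrow> ((real^'i::finite) \<times> 'y) set \<Rightarrow> real \<Rightarrow> real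
     \<Rightarrow> (nat \<Rightarrow> (nat \<Rightarrow> nat) \<Rightarrow> (nat \<Rightarrow> nat \<Rightarrow> nat \<Rightarrow> real) \<Rightarrow> real \<Rightarrow> real \<Rightarrow> real)
     \<Rightarrow> (nat \<Rightarrow> nat) \<Rightarrow> (nat \<Rightarrow> nat \<Rightarrow> nat \<Rightarrow> real) \<Rightarrow> real" where
  "energy L \<sigma> e D lam p \<Omega> d W =
     (\<Sum>(x, y)\<in>D. e (net L \<sigma> d W x) y) / real (card D) + \<Omega> L d W lam p"

definition activation_ok :: "(real \<Rightarrow> real) \<Rightarrow> bool" where
  "activation_ok s \<longleftrightarrow>
     (\<exists>b1. (\<forall>S\<ge>0. b1 S \<ge> 0) \<and> (\<forall>S\<ge>0. \<forall>t. \<bar>t\<bar> \<le> S \<longrightarrow> \<bar>s t\<bar> \<le> b1 S * \<bar>t\<bar>)) \<and>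
     (\<forall>t. (\<exists>D. (s has_real_derivative D) (at_left t)) \<and> (\<exists>D. (s has_real_derivative D) (at_right t))) \<and>
     (\<exists>b2. (\<forall>S\<ge>0. b2 S \<ge> 0) \<and> (\<forall>S\<ge>0. \<forall>t. \<bar>t\<bar> \<le> S \<longrightarrow>
        (\<forall>D. (s has_real_derivative D) (at_left t) \<longrightarrow> \<bar>D\<bar> \<le> b2 S) \<and>
        (\<forall>D. (s has_real_derivative D) (at_right t) \<longrightarrow> \<bar>D\<bar> \<le> b2 S)))"

definition error_ok :: "(real^'o::finite \<Rightarrow> 'y \<Rightarrow> real) \<Rightarrow> bool" where
  "error_ok e \<longleftrightarrow>
     (\<forall>v y. 0 \<le> e v y) \<and>
     (\<forall>v y. (\<lambda>u. e u y) differentiable (at v)) \<and>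
     (\<exists>b3. (\<forall>S\<ge>0. b3 S \<ge> 0) \<and> (\<forall>S\<ge>0. \<forall>v y. e v y \<le> S \<longrightarrow>
        (\<forall>k. \<bar>frechet_derivative (\<lambda>u. e u y) (at v) (axis k 1)\<bar> \<le> b3 S)))"

end

theory Submission
  imports Defs
begin

text \<open>
  Deleting a hidden unit changes the output by at most a constant, independent of all widths,
  times the product of its fan-in and fan-out, while it saves \<open>\<lambda>\<close> times the norm of the
  penalised fan. Hence a unit whose unpenalised fan is small can be deleted without increasing the
  energy. Since the total penalty is bounded by the energy divided by \<open>\<lambda>\<close>, a layer
  contains only boundedly many other units as soon as the adjacent layer, on the side of the
  unpenalised fan, has bounded width; starting at the output layer (for \<open>Omega_in\<close>) or
  at the input (for \<open>Omega_out\<close>), this bounds every width. So only finitely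
  many width vectors matter, and for each of them the energy is continuous and coercive in the weights.
\<close>

subsection \<open>One-sided derivatives and Lipschitz bounds\<close>

text \<open>The obstacle is uniformity. The growth and Lipschitz conditions on
  \<open>\<sigma>\<close> and the derivative condition on \<open>e\<close> are only local, while the
  networks to be compared have arbitrary widths. A bound on the total penalty alone must therefore
  confine all activations and pre-activations to fixed intervals; this forces norms in which a layer
  is controlled by its penalty without any dimension factor. The constants obtained in this way
  combine to one number \<open>Q\<close>: if the unpenalised fan of a unit has size at most
  \<open>c\<close> and its penalised fan has norm \<open>w\<close>, deletion raises the error at
  each data point by at most \<open>Q * c * w\<close> and saves \<open>lam * w\<close>, so any
  \<open>c\<close> with \<open>Q * c \<le> lam\<close> will do. Units with a larger unpenalised fan
  are few because \<open>p\<close> is finite: each of them adds a fixed amount to a sum of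
  \<open>p\<close>-th powers that the penalty bounds. Deletion never raises the cost, so the same
  penalty bound, and with it the same constants, stays valid along a whole chain of
  deletions.\<close>

lemma one_sided_derivative_bound_imp_lipschitz:
  fixes s :: "real \<Rightarrow> real"
  assumes ab: "a \<le> b"
    and left: "\<And>t. t \<in> {a..b} \<Longrightarrow> \<exists>D. (s has_real_derivative D) (at_left t) \<and> \<bar>D\<bar> \<le> M"
    and right: "\<And>t. t \<in> {a..b} \<Longrightarrow> \<exists>D. (s has_real_derivative D) (at_right t) \<and> \<bar>D\<bar> \<le> M"
  shows "\<bar>s b - s a\<bar> \<le> M * (b - a)"
proof -
  have local_bound: "eventually (\<lambda>u. \<bar>s u - s t\<bar> \<le> c * \<bar>u - t\<bar>) (at t within S)"
    if "(s has_real_derivative D) (at t within S)" "\<bar>D\<bar> < c" for c D t S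
  proof -
    have "((\<lambda>u. \<bar>(s u - s t) / (u - t)\<bar>) \<longlongrightarrow> \<bar>D\<bar>) (at t within S)"
      using that(1) unfolding has_field_derivative_iff by (rule tendsto_rabs)
    then have "eventually (\<lambda>u. \<bar>(s u - s t) / (u - t)\<bar> < c) (at t within S)"
      using order_tendstoD(2) that(2) by blast
    moreover have "eventually (\<lambda>u. u \<noteq> t) (at t within S)"
      by (simp add: eventually_at_filter)
    ultimately show ?thesis
      by eventually_elim (auto simp: divide_simps split: if_splits)
  qed
  \<comment> \<open>The left and right derivatives may differ, so the mean value theorem does not
    apply. With slack \<open>\<epsilon>\<close> the bound holds near every point, and bisection
    extends it to the whole interval.\<close>
  have "\<bar>s b - s a\<bar> \<le> (M + \<epsilon>) * (b - a)" if "\<epsilon> > 0" for \<epsilon>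
    using ab
  proof (induction rule: Bolzano)
    case (trans a b c)
    then show ?case by (auto simp: algebra_simps)
  next
    case (local x)
    obtain D1 D2 where D1: "(s has_real_derivative D1) (at_left x)" "\<bar>D1\<bar> \<le> M"
      and D2: "(s has_real_derivative D2) (at_right x)" "\<bar>D2\<bar> \<le> M"
      using left[of x] right[of x] local by auto
    have "eventually (\<lambda>u. \<bar>s u - s x\<bar> \<le> (M + \<epsilon>) * \<bar>u - x\<bar>) (at_left x)"
      using local_bound[OF D1(1)] D1(2) that by auto
    moreover have "eventually (\<lambda>u. \<bar>s u - s x\<bar> \<le> (M + \<epsilon>) * \<bar>u - x\<bar>) (at_right x)"
      using local_bound[OF D2(1)] D2(2) that by auto
    ultimately have "eventually (\<lambda>u. \<bar>s u - s x\<bar> \<le> (M + \<epsilon>) * \<bar>u - x\<bar>) (at x)"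
      by (simp add: eventually_at_split)
    then obtain \<delta> where \<delta>: "\<delta> > 0" "\<And>u. u \<noteq> x \<Longrightarrow> \<bar>u - x\<bar> < \<delta> \<Longrightarrow> \<bar>s u - s x\<bar> \<le> (M + \<epsilon>) * \<bar>u - x\<bar>"
      by (auto simp: eventually_at dist_real_def)
    have \<delta>': "\<bar>s u - s x\<bar> \<le> (M + \<epsilon>) * \<bar>u - x\<bar>" if "\<bar>u - x\<bar> < \<delta>" for u
      using \<delta>(2)[of u] that by (cases "u = x") auto
    \<comment> \<open>The derivatives at \<open>x\<close> control only increments that start at
      \<open>x\<close>; an interval containing \<open>x\<close> is split there.\<close>
    have "\<bar>s v - s u\<bar> \<le> (M + \<epsilon>) * (v - u)" if "u \<le> x" "x \<le> v" "v - u < \<delta>" for u v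
      using \<delta>'[of u] \<delta>'[of v] that by (auto simp: algebra_simps)
    then show ?case
      using \<delta>(1) by blast
  qed
  then have "\<bar>s b - s a\<bar> \<le> M * (b - a) + e" if "e > 0" for e
  proof (cases "a = b")
    case True
    then show ?thesis using that by auto
  next
    case False
    then have "b - a > 0" using ab by auto
    then show ?thesis
      using \<open>\<And>\<epsilon>. \<epsilon> > 0 \<Longrightarrow> _ \<epsilon>\<close>[of "e / (b - a)"] that
      by (simp add: distrib_right)
  qed
  then show ?thesis
    by (rule field_le_epsilon)
qed

lemma activation_zero:
  assumes "activation_ok s"
  shows "s 0 = 0"
proof -
  obtain b1 where "\<forall>S\<ge>0. \<forall>t. \<bar>t\<bar> \<le> S \<longrightarrow> \<bar>s t\<bar> \<le> b1 S * \<bar>t\<bar>"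
    using assms unfolding activation_ok_def by blast
  then have "\<bar>s 0\<bar> \<le> b1 0 * \<bar>0\<bar>"
    by fastforce
  then show ?thesis by simp
qed

lemma activation_lipschitz:
  assumes "activation_ok s" "0 \<le> S"
  obtains K where "0 \<le> K" "\<And>t u. \<bar>t\<bar> \<le> S \<Longrightarrow> \<bar>u\<bar> \<le> S \<Longrightarrow> \<bar>s t - s u\<bar> \<le> K * \<bar>t - u\<bar>"
proof -
  have ex: "\<exists>D. (s has_real_derivative D) (at_left t)" "\<exists>D. (s has_real_derivative D) (at_right t)" for t
    using assms(1) by (simp_all add: activation_ok_def)
  obtain b2 where "(\<forall>S\<ge>0. b2 S \<ge> 0) \<and> (\<forall>S\<ge>0. \<forall>t. \<bar>t\<bar> \<le> S \<longrightarrow>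
        (\<forall>D. (s has_real_derivative D) (at_left t) \<longrightarrow> \<bar>D\<bar> \<le> b2 S) \<and>
        (\<forall>D. (s has_real_derivative D) (at_right t) \<longrightarrow> \<bar>D\<bar> \<le> b2 S))"
    using assms(1) unfolding activation_ok_def by (elim conjE exE) (rule that, intro conjI)
  then have b2: "b2 S \<ge> 0"
      "\<And>t D. \<bar>t\<bar> \<le> S \<Longrightarrow> (s has_real_derivative D) (at_left t) \<Longrightarrow> \<bar>D\<bar> \<le> b2 S"
      "\<And>t D. \<bar>t\<bar> \<le> S \<Longrightarrow> (s has_real_derivative D) (at_right t) \<Longrightarrow> \<bar>D\<bar> \<le> b2 S"
    using assms(2) by simp_all
  have le: "\<bar>s t - s u\<bar> \<le> b2 S * (t - u)" if "u \<le> t" "\<bar>t\<bar> \<le> S" "\<bar>u\<bar> \<le> S" for t u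
  proof (rule one_sided_derivative_bound_imp_lipschitz[OF that(1)])
    fix w assume "w \<in> {u..t}"
    then have "\<bar>w\<bar> \<le> S" using that by auto
    then show "\<exists>D. (s has_real_derivative D) (at_left w) \<and> \<bar>D\<bar> \<le> b2 S"
      "\<exists>D. (s has_real_derivative D) (at_right w) \<and> \<bar>D\<bar> \<le> b2 S"
      using ex[of w] b2 by blast+
  qed
  have "\<bar>s t - s u\<bar> \<le> b2 S * \<bar>t - u\<bar>" if "\<bar>t\<bar> \<le> S" "\<bar>u\<bar> \<le> S" for t u
    using le[of t u] le[of u t] that by (cases "u \<le> t") (auto simp: abs_minus_commute)
  then show thesis
    using that b2(1) by blast
qed

lemma activation_continuous:
  assumes "activation_ok s"
  shows "continuous_on UNIV s"
proof -
  have "\<exists>D. (s has_real_derivative D) (at_left t)" "\<exists>D. (s has_real_derivative D) (at_right t)" for t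
    using assms by (simp_all add: activation_ok_def)
  then have "isCont s t" for t
    unfolding continuous_at_split by (blast intro: DERIV_continuous)
  then show ?thesis
    by (simp add: continuous_on_eq_continuous_at)
qed

lemma error_continuous:
  assumes "error_ok e"
  shows "continuous_on A (\<lambda>u. e u y)"
proof (rule continuous_at_imp_continuous_on, rule ballI, rule differentiable_imp_continuous_within)
  show "(\<lambda>u. e u y) differentiable (at v)" for v
    using assms by (simp add: error_ok_def)
qed

lemma error_lipschitz:
  fixes e :: "real^'o::finite \<Rightarrow> 'y \<Rightarrow> real"
  assumes e: "error_ok e" and Y: "finite Y"
  obtains K where "0 \<le> K"
    "\<And>u v y. y \<in> Y \<Longrightarrow> norm u \<le> r \<Longrightarrow> norm v \<le> r \<Longrightarrow> \<bar>e u y - e v y\<bar> \<le> K * norm (u - v)"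
proof -
  have diff: "\<And>v y. (\<lambda>u. e u y) differentiable (at v)"
    using e by (simp add: error_ok_def)
  obtain b3 where "(\<forall>S\<ge>0. b3 S \<ge> 0) \<and> (\<forall>S\<ge>0. \<forall>v y. e v y \<le> S \<longrightarrow>
        (\<forall>k. \<bar>frechet_derivative (\<lambda>u. e u y) (at v) (axis k 1)\<bar> \<le> b3 S))"
    using e unfolding error_ok_def by (elim conjE exE) (rule that, intro conjI)
  then have b3: "S \<ge> 0 \<Longrightarrow> b3 S \<ge> 0"
    "S \<ge> 0 \<Longrightarrow> e v y \<le> S \<Longrightarrow> \<bar>frechet_derivative (\<lambda>u. e u y) (at v) (axis k 1)\<bar> \<le> b3 S" for S v y k
    by simp_all
  have "\<exists>K\<ge>0. \<forall>u v. norm u \<le> r \<longrightarrow> norm v \<le> r \<longrightarrow> \<bar>e u y - e v y\<bar> \<le> K * norm (u - v)" for y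
  proof -
    \<comment> \<open>The derivative of \<open>e\<close> is bounded only where \<open>e\<close>
      itself is. Continuity on a compact ball supplies a level \<open>S\<close>, hence the
      derivative bound \<open>b3 S\<close> on the whole ball.\<close>
    have "compact ((\<lambda>u. e u y) ` cball 0 r)"
      by (intro compact_continuous_image error_continuous e compact_cball)
    then obtain S where S: "S > 0" "\<And>u. norm u \<le> r \<Longrightarrow> e u y \<le> S"
      by (force dest!: compact_imp_bounded simp: bounded_pos)
    define K where "K = b3 S * real CARD('o)"
    have "norm (e u y - e v y) \<le> K * norm (u - v)" if "norm u \<le> r" "norm v \<le> r" for u v
    proof (rule differentiable_bound)
      show "convex (cball 0 r :: (real^'o) set)" by simp
      fix w :: "real^'o" assume w: "w \<in> cball 0 r"
      let ?D = "frechet_derivative (\<lambda>u. e u y) (at w)"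
      have D: "((\<lambda>u. e u y) has_derivative ?D) (at w)"
        using diff frechet_derivative_works by blast
      then show "((\<lambda>u. e u y) has_derivative ?D) (at w within cball 0 r)"
        by (rule has_derivative_at_withinI)
      have lin: "linear ?D"
        using D has_derivative_linear by blast
      have "norm (?D h) \<le> K * norm h" for h
      proof -
        have "?D h = ?D (\<Sum>k\<in>UNIV. h $ k *\<^sub>R axis k 1)"
          using basis_expansion[of h] by (simp add: scalar_mult_eq_scaleR)
        also have "\<dots> = (\<Sum>k\<in>UNIV. h $ k * ?D (axis k 1))"
          by (simp add: linear_sum[OF lin] linear_cmul[OF lin])
        also have "\<bar>\<dots>\<bar> \<le> (\<Sum>k\<in>(UNIV :: 'o set). norm h * b3 S)"
        proof (rule order_trans[OF sum_abs], rule sum_mono)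
          fix k show "\<bar>h $ k * ?D (axis k 1)\<bar> \<le> norm h * b3 S"
            unfolding abs_mult using b3(2)[of S w y k] S w
            by (intro mult_mono) (auto simp: component_le_norm_cart)
        qed
        finally show ?thesis
          by (simp add: K_def mult_ac)
      qed
      then show "onorm ?D \<le> K"
        by (rule onorm_le)
    qed (use that in auto)
    moreover have "K \<ge> 0"
      unfolding K_def using b3(1) S by simp
    ultimately show ?thesis by auto
  qed
  then obtain K where K: "\<And>y. K y \<ge> 0"
    "\<And>y u v. norm u \<le> r \<Longrightarrow> norm v \<le> r \<Longrightarrow> \<bar>e u y - e v y\<bar> \<le> K y * norm (u - v)"
    by metis
  show thesis
  \<comment> \<open>The constant depends on the label; finitely many labels are covered by the sum
    of their constants.\<close>
  proof (rule that[of "\<Sum>y\<in>Y. K y"])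
    show "0 \<le> (\<Sum>y\<in>Y. K y)" using K by (simp add: sum_nonneg)
    fix u v :: "real^'o" and y assume "y \<in> Y" "norm u \<le> r" "norm v \<le> r"
    then have "\<bar>e u y - e v y\<bar> \<le> K y * norm (u - v)" using K by blast
    also have "\<dots> \<le> (\<Sum>y\<in>Y. K y) * norm (u - v)"
      using \<open>y \<in> Y\<close> Y K by (intro mult_right_mono member_le_sum) auto
    finally show "\<bar>e u y - e v y\<bar> \<le> (\<Sum>y\<in>Y. K y) * norm (u - v)" .
  qed
qed

lemma idx_inv_less: "idx_inv (k :: 'a::finite) < CARD('a)"
proof -
  have "\<exists>f. bij_betw f {..<CARD('a)} (UNIV :: 'a set)"
    using ex_bij_betw_nat_finite[of "UNIV :: 'a set"] by (auto simp: atLeast0LessThan)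
  then have "bij_betw (idx :: nat \<Rightarrow> 'a) {..<CARD('a)} UNIV"
    unfolding idx_def by (rule someI_ex)
  then show ?thesis
    unfolding idx_inv_def using inv_into_into[of k idx "{..<CARD('a)}"]
    by (auto simp: bij_betw_def)
qed

subsection \<open>Column norms\<close>

lemma lpnorm_nonneg: "0 \<le> lpnorm p n v"
  by (simp add: lpnorm_def)

lemma lpnorm_powr: "0 < p \<Longrightarrow> lpnorm p n v powr p = (\<Sum>i<n. \<bar>v i\<bar> powr p)"
  by (simp add: lpnorm_def powr_powr sum_nonneg)

lemma abs_le_lpnorm:
  assumes "0 < p" "i < n"
  shows "\<bar>v i\<bar> \<le> lpnorm p n v"
proof -
  have "\<bar>v i\<bar> = (\<bar>v i\<bar> powr p) powr (1 / p)"
    using assms by (simp add: powr_powr)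
  also have "\<dots> \<le> lpnorm p n v"
    unfolding lpnorm_def using assms
    by (intro powr_mono2 member_le_sum[of i _ "\<lambda>i. \<bar>v i\<bar> powr p"]) auto
  finally show ?thesis .
qed

lemma lpnorm_reindex_le:
  assumes "0 < p" "bij_betw h {..<m} A" "A \<subseteq> {..<n}"
  shows "lpnorm p m (\<lambda>i. v (h i)) \<le> lpnorm p n v"
proof -
  have "(\<Sum>i<m. \<bar>v (h i)\<bar> powr p) = (\<Sum>i\<in>A. \<bar>v i\<bar> powr p)"
    using sum.reindex_bij_betw[OF assms(2), of "\<lambda>i. \<bar>v i\<bar> powr p"] .
  also have "\<dots> \<le> (\<Sum>i<n. \<bar>v i\<bar> powr p)"
    using assms by (intro sum_mono2) auto
  finally show ?thesis
    unfolding lpnorm_def using assms by (intro powr_mono2) (auto simp: sum_nonneg)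
qed

lemma continuous_on_lpnorm:
  assumes "0 < p" "\<And>i. i < n \<Longrightarrow> continuous_on S (\<lambda>x. v x i)"
  shows "continuous_on S (\<lambda>x. lpnorm p n (v x))"
  unfolding lpnorm_def using assms
  by (intro continuous_on_powr' continuous_on_sum continuous_on_rabs continuous_on_const)
     (auto simp: sum_nonneg)

text \<open>The contribution of one layer to \<open>Omega_in\<close>, without the factor
  \<open>lam\<close>. Applied to the transposed matrix it is the contribution to
  \<open>Omega_out\<close>, so both regularizers share the lemmas below.\<close>

definition col_pen :: "real \<Rightarrow> nat \<Rightarrow> nat \<Rightarrow> (nat \<Rightarrow> nat \<Rightarrow> real) \<Rightarrow> real" where
  "col_pen p n m A = (\<Sum>j<m. lpnorm p n (\<lambda>i. A i j))"

lemma col_pen_nonneg: "0 \<le> col_pen p n m A"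
  by (simp add: col_pen_def sum_nonneg lpnorm_nonneg)

lemma column_le_col_pen: "j < m \<Longrightarrow> lpnorm p n (\<lambda>i. A i j) \<le> col_pen p n m A"
  unfolding col_pen_def
  by (rule member_le_sum[of j _ "\<lambda>j. lpnorm p n (\<lambda>i. A i j)"]) (auto simp: lpnorm_nonneg)

lemma entry_le_col_pen:
  assumes "0 < p" "i < n" "j < m"
  shows "\<bar>A i j\<bar> \<le> col_pen p n m A"
  using abs_le_lpnorm[of p i n "\<lambda>i. A i j"] column_le_col_pen[of j m p n A] assms by linarith

lemma col_pen_cong:
  assumes "\<And>i j. i < n \<Longrightarrow> j < m \<Longrightarrow> A i j = B i j"
  shows "col_pen p n m A = col_pen p n m B"
  using assms unfolding col_pen_def lpnorm_def by simp

lemma continuous_on_entry: "continuous_on S (\<lambda>A :: nat \<Rightarrow> nat \<Rightarrow> real. A i j)"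
  by (rule continuous_on_product_then_coordinatewise[of S "\<lambda>A. A i"],
      rule continuous_on_product_then_coordinatewise[of S "\<lambda>A. A"], rule continuous_on_id)

lemma continuous_on_col_pen:
  assumes "0 < p"
  shows "continuous_on S (\<lambda>A. col_pen p n m A)" "continuous_on S (\<lambda>A. col_pen p n m (\<lambda>i j. A j i))"
  unfolding col_pen_def using assms
  by (intro continuous_on_sum continuous_on_lpnorm continuous_on_entry; simp)+

text \<open>The units of a layer are always numbered by an initial segment of the naturals, so a
  deletion must renumber the survivors; \<open>h\<close> is such a renumbering, and its choice does
  not matter.\<close>

lemma col_pen_delete_column:
  assumes "j < m" "bij_betw h {..<m - 1} ({..<m} - {j})"
  shows "col_pen p n (m - 1) (\<lambda>i k. A i (h k)) + lpnorm p n (\<lambda>i. A i j) = col_pen p n m A"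
proof -
  have "col_pen p n (m - 1) (\<lambda>i k. A i (h k)) = (\<Sum>k\<in>{..<m} - {j}. lpnorm p n (\<lambda>i. A i k))"
    unfolding col_pen_def using sum.reindex_bij_betw[OF assms(2), of "\<lambda>k. lpnorm p n (\<lambda>i. A i k)"] .
  then show ?thesis
    unfolding col_pen_def using assms(1) by (simp add: sum.remove[of "{..<m}" j])
qed

lemma col_pen_delete_row:
  assumes "0 < p" "bij_betw h {..<m - 1} ({..<m} - {j})"
  shows "col_pen p (m - 1) r (\<lambda>i k. B (h i) k) \<le> col_pen p m r B"
  unfolding col_pen_def
  by (intro sum_mono lpnorm_reindex_le[OF assms, where v = "\<lambda>i. B i _"]) auto

text \<open>Double counting of the \<open>p\<close>-th powers of all entries. Counted by columns,
  they add up to at most \<open>M * R powr p\<close>; counted by rows, every heavy row contributes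
  at least a fixed \<open>q\<close>. Hence the number of rows is bounded if all of them are
  heavy.\<close>

lemma light_row_exists:
  assumes p: "0 < p" and c: "0 < c"
  shows "\<exists>N. \<forall>m r B. r \<le> M \<and> col_pen p m r B \<le> R \<and> N < m \<longrightarrow> (\<exists>j<m. (\<Sum>k<r. \<bar>B j k\<bar>) \<le> c)"
proof -
  \<comment> \<open>A row of at most \<open>M\<close> entries whose absolute sum exceeds
    \<open>c\<close> has an entry of size at least \<open>c / (M + 1)\<close>. Using
    \<open>M + 1\<close> avoids division by zero for \<open>M = 0\<close>.\<close>
  define q where "q = (c / real (M + 1)) powr p"
  have q: "q > 0" using c by (simp add: q_def)
  have "\<exists>j<m. (\<Sum>k<r. \<bar>B j k\<bar>) \<le> c"
    if r: "r \<le> M" and R: "col_pen p m r B \<le> R" and m: "nat \<lceil>M * R powr p / q\<rceil> < m" for m r B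
  proof (rule ccontr)
    assume heavy: "\<not> ?thesis"
    have row: "q \<le> (\<Sum>k<r. \<bar>B j k\<bar> powr p)" if "j < m" for j
    proof -
      have "\<exists>k<r. c / real (M + 1) \<le> \<bar>B j k\<bar>"
      proof (rule ccontr)
        assume "\<not> ?thesis"
        then have "(\<Sum>k<r. \<bar>B j k\<bar>) \<le> (\<Sum>k<r. c / real (M + 1))"
          by (intro sum_mono) force
        also have "\<dots> = real r * c / real (M + 1)" by simp
        also have "\<dots> \<le> real (M + 1) * c / real (M + 1)"
          using r c by (intro divide_right_mono mult_right_mono) auto
        also have "\<dots> = c" by simp
        finally show False using heavy that by blast
      qed
      then obtain k where k: "k < r" "c / real (M + 1) \<le> \<bar>B j k\<bar>" by blast
      have "q \<le> \<bar>B j k\<bar> powr p"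
        unfolding q_def using k c p by (intro powr_mono2) auto
      also have "\<dots> \<le> (\<Sum>k<r. \<bar>B j k\<bar> powr p)"
        using k by (intro member_le_sum[of k _ "\<lambda>k. \<bar>B j k\<bar> powr p"]) auto
      finally show ?thesis .
    qed
    have "real m * q = (\<Sum>j<m. q)" by simp
    also have "\<dots> \<le> (\<Sum>j<m. \<Sum>k<r. \<bar>B j k\<bar> powr p)"
      using row by (intro sum_mono) auto
    also have "\<dots> = (\<Sum>k<r. lpnorm p m (\<lambda>j. B j k) powr p)"
      unfolding lpnorm_powr[OF p] by (rule sum.swap)
    also have "\<dots> \<le> (\<Sum>k<r. R powr p)"
    proof (rule sum_mono)
      fix k assume "k \<in> {..<r}"
      then have "lpnorm p m (\<lambda>j. B j k) \<le> R"
        using column_le_col_pen[of k r p m B] R by auto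
      then show "lpnorm p m (\<lambda>j. B j k) powr p \<le> R powr p"
        using p by (intro powr_mono2) (auto simp: lpnorm_nonneg)
    qed
    also have "\<dots> \<le> M * R powr p"
      using r by (simp add: mult_right_mono)
    finally have "real m \<le> M * R powr p / q"
      using q by (simp add: field_simps)
    then show False
      using m by linarith
  qed
  then show ?thesis by blast
qed

subsection \<open>Penalties compatible with a norm\<close>

text \<open>
  For \<open>Omega_in\<close>, \<open>nrm\<close> is the sum norm and \<open>pen\<close> adds the column norms; for
  \<open>Omega_out\<close>, \<open>nrm\<close> is the maximum norm and \<open>pen\<close> adds the row norms. Either
  way \<open>pen\<close> dominates the operator norm for \<open>nrm\<close> whatever the dimensions.
  In \<open>removal\<close>, \<open>A\<close> and \<open>B\<close> are the weights entering and leaving a layer of \<open>m\<close>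
  units, \<open>w\<close> is the penalty saved by deleting unit \<open>j\<close>, and \<open>nb\<close> selects the
  neighbouring width on the side of the unpenalised fan.
\<close>
locale layer_penalty =
  fixes nrm :: "nat \<Rightarrow> (nat \<Rightarrow> real) \<Rightarrow> real"
    and pen :: "nat \<Rightarrow> nat \<Rightarrow> (nat \<Rightarrow> nat \<Rightarrow> real) \<Rightarrow> real"
    and nb :: "nat \<Rightarrow> nat \<Rightarrow> nat"
  assumes nrm_nonneg: "0 \<le> nrm n v"
    and abs_le_nrm: "j < n \<Longrightarrow> \<bar>v j\<bar> \<le> nrm n v"
    and nrm_dominated: "0 \<le> C \<Longrightarrow> (\<And>j. j < n \<Longrightarrow> \<bar>u j\<bar> \<le> C * \<bar>v j\<bar>) \<Longrightarrow> nrm n u \<le> C * nrm n v"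
    and nrm_mult: "nrm m (\<lambda>k. \<Sum>i<n. v i * A i k) \<le> nrm n v * pen n m A"
    and pen_nonneg: "0 \<le> pen n m A"
    and entry_le_pen: "i < n \<Longrightarrow> j < m \<Longrightarrow> \<bar>A i j\<bar> \<le> pen n m A"
    and pen_cong: "(\<And>i j. i < n \<Longrightarrow> j < m \<Longrightarrow> A i j = B i j) \<Longrightarrow> pen n m A = pen n m B"
    and continuous_pen: "continuous_on UNIV (pen n m)"
    and nb_cases: "nb = (\<lambda>n r. n) \<or> nb = (\<lambda>n r. r)"
    and removal: "0 < c \<Longrightarrow> \<exists>N. \<forall>n m r A B.
      pen n m A \<le> R \<and> pen m r B \<le> R \<and> nb n r \<le> M \<and> N < m \<longrightarrow>
      (\<exists>j<m. \<exists>w\<ge>0.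
        (\<forall>x. \<bar>\<Sum>i<n. x i * A i j\<bar> * nrm r (B j) \<le> c * w * nrm n x) \<and>
        (\<forall>h. bij_betw h {..<m - 1} ({..<m} - {j}) \<longrightarrow>
          pen n (m - 1) (\<lambda>i k. A i (h k)) + pen (m - 1) r (\<lambda>i k. B (h i) k) + w
            \<le> pen n m A + pen m r B))"

text \<open>Each entry of a column is at most the norm of the column, so column \<open>k\<close>
  maps \<open>v\<close> to a number of size at most the sum norm of \<open>v\<close> times that
  column norm. Adding over \<open>k\<close> gives the operator bound with no factor depending on the
  dimensions.\<close>

lemma layer_penalty_in:
  assumes p: "1 \<le> p"
  shows "layer_penalty (\<lambda>n v. \<Sum>i<n. \<bar>v i\<bar>) (col_pen p) (\<lambda>n r. r)"
proof
  have p0: "0 < p" using p by simp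
  fix n m r M :: nat and v u :: "nat \<Rightarrow> real" and A B :: "nat \<Rightarrow> nat \<Rightarrow> real" and i j :: nat and c C R :: real
  show "0 \<le> (\<Sum>i<n. \<bar>v i\<bar>)" by (simp add: sum_nonneg)
  show "\<bar>v j\<bar> \<le> (\<Sum>i<n. \<bar>v i\<bar>)" if "j < n"
    using that by (intro member_le_sum[of j _ "\<lambda>i. \<bar>v i\<bar>"]) auto
  show "(\<Sum>i<n. \<bar>u i\<bar>) \<le> C * (\<Sum>i<n. \<bar>v i\<bar>)" if "\<And>j. j < n \<Longrightarrow> \<bar>u j\<bar> \<le> C * \<bar>v j\<bar>"
    using that by (auto simp: sum_distrib_left intro: sum_mono)
  have column: "\<bar>\<Sum>i<n. v i * A i k\<bar> \<le> (\<Sum>i<n. \<bar>v i\<bar>) * lpnorm p n (\<lambda>i. A i k)" for n v A k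
  proof -
    have "\<bar>\<Sum>i<n. v i * A i k\<bar> \<le> (\<Sum>i<n. \<bar>v i * A i k\<bar>)" by (rule sum_abs)
    also have "\<dots> \<le> (\<Sum>i<n. \<bar>v i\<bar> * lpnorm p n (\<lambda>i. A i k))"
      unfolding abs_mult using abs_le_lpnorm[OF p0, of _ n "\<lambda>i. A i k"]
      by (intro sum_mono mult_left_mono) auto
    finally show ?thesis by (simp add: sum_distrib_right)
  qed
  show "(\<Sum>k<m. \<bar>\<Sum>i<n. v i * A i k\<bar>) \<le> (\<Sum>i<n. \<bar>v i\<bar>) * col_pen p n m A"
    unfolding col_pen_def sum_distrib_left[of _ _ "{..<m}"] by (intro sum_mono column)
  show "0 \<le> col_pen p n m A" by (rule col_pen_nonneg)
  show "\<bar>A i j\<bar> \<le> col_pen p n m A" if "i < n" "j < m"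
    using entry_le_col_pen[OF p0] that by blast
  show "col_pen p n m A = col_pen p n m B" if "\<And>i j. i < n \<Longrightarrow> j < m \<Longrightarrow> A i j = B i j"
    using that by (rule col_pen_cong)
  show "continuous_on UNIV (col_pen p n m)" by (rule continuous_on_col_pen(1)[OF p0])
  show "(\<lambda>n r. r) = (\<lambda>n r :: nat. n) \<or> (\<lambda>n r. r) = (\<lambda>n r :: nat. r)" by simp
  assume c: "0 < c"
  obtain N where N: "\<And>m r B. r \<le> M \<Longrightarrow> col_pen p m r B \<le> R \<Longrightarrow> N < m \<Longrightarrow> \<exists>j<m. (\<Sum>k<r. \<bar>B j k\<bar>) \<le> c"
    using light_row_exists[OF p0 c] by metis
  show "\<exists>N. \<forall>n m r A B.
      col_pen p n m A \<le> R \<and> col_pen p m r B \<le> R \<and> r \<le> M \<and> N < m \<longrightarrow>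
      (\<exists>j<m. \<exists>w\<ge>0.
        (\<forall>x. \<bar>\<Sum>i<n. x i * A i j\<bar> * (\<Sum>i<r. \<bar>B j i\<bar>) \<le> c * w * (\<Sum>i<n. \<bar>x i\<bar>)) \<and>
        (\<forall>h. bij_betw h {..<m - 1} ({..<m} - {j}) \<longrightarrow>
          col_pen p n (m - 1) (\<lambda>i k. A i (h k)) + col_pen p (m - 1) r (\<lambda>i k. B (h i) k) + w
            \<le> col_pen p n m A + col_pen p m r B))"
  proof (rule exI[of _ N], intro allI impI, elim conjE)
    fix n m r A B
    assume "col_pen p m r B \<le> R" "r \<le> M" "N < m"
    then obtain j where j: "j < m" "(\<Sum>k<r. \<bar>B j k\<bar>) \<le> c" using N by blast
    \<comment> \<open>The fan-in of unit \<open>j\<close> is one penalised column, so its norm is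
      saved in full; the light row bounds the fan-out by \<open>c\<close>. Losing row
      \<open>j\<close> of \<open>B\<close> only shrinks the remaining column norms.\<close>
    let ?w = "lpnorm p n (\<lambda>i. A i j)"
    have "\<bar>\<Sum>i<n. x i * A i j\<bar> * (\<Sum>i<r. \<bar>B j i\<bar>) \<le> (\<Sum>i<n. \<bar>x i\<bar>) * ?w * c" for x
      using j column[of x A j n] by (intro mult_mono) (auto simp: sum_nonneg lpnorm_nonneg)
    moreover have "col_pen p n (m - 1) (\<lambda>i k. A i (h k)) + col_pen p (m - 1) r (\<lambda>i k. B (h i) k) + ?w
            \<le> col_pen p n m A + col_pen p m r B" if "bij_betw h {..<m - 1} ({..<m} - {j})" for h
      using col_pen_delete_column[OF j(1) that, of p n A] col_pen_delete_row[OF p0 that, of r B] by linarith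
    ultimately show "\<exists>j<m. \<exists>w\<ge>0.
        (\<forall>x. \<bar>\<Sum>i<n. x i * A i j\<bar> * (\<Sum>i<r. \<bar>B j i\<bar>) \<le> c * w * (\<Sum>i<n. \<bar>x i\<bar>)) \<and>
        (\<forall>h. bij_betw h {..<m - 1} ({..<m} - {j}) \<longrightarrow>
          col_pen p n (m - 1) (\<lambda>i k. A i (h k)) + col_pen p (m - 1) r (\<lambda>i k. B (h i) k) + w
            \<le> col_pen p n m A + col_pen p m r B)"
      using j(1) by (intro exI[of _ j] conjI exI[of _ ?w] allI impI) (simp_all add: lpnorm_nonneg mult_ac)
  qed
qed

text \<open>Inserting \<open>0\<close> gives the maximum a meaning for \<open>n = 0\<close> and
  changes nothing otherwise.\<close>

definition max_nrm :: "nat \<Rightarrow> (nat \<Rightarrow> real) \<Rightarrow> real" where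
  "max_nrm n v = Max (insert 0 ((\<lambda>i. \<bar>v i\<bar>) ` {..<n}))"

lemma max_nrm_le_iff: "max_nrm n v \<le> B \<longleftrightarrow> 0 \<le> B \<and> (\<forall>i<n. \<bar>v i\<bar> \<le> B)"
  by (auto simp: max_nrm_def)

lemma abs_le_max_nrm: "i < n \<Longrightarrow> \<bar>v i\<bar> \<le> max_nrm n v"
  using max_nrm_le_iff[of n v "max_nrm n v"] by simp

lemma max_nrm_nonneg: "0 \<le> max_nrm n v"
  using max_nrm_le_iff[of n v "max_nrm n v"] by simp

text \<open>Dual to the previous case: with the maximum norm on activations, an output coordinate is
  bounded by the absolute column sum of \<open>A\<close>, and each summand there is at most the norm
  of its row.\<close>

lemma layer_penalty_out:
  assumes p: "1 \<le> p"
  shows "layer_penalty max_nrm (\<lambda>n m A. col_pen p m n (\<lambda>j i. A i j)) (\<lambda>n r. n)"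
proof
  have p0: "0 < p" using p by simp
  fix n m r M :: nat and v u :: "nat \<Rightarrow> real" and A B :: "nat \<Rightarrow> nat \<Rightarrow> real" and i j :: nat and c C R :: real
  show "0 \<le> max_nrm n v" by (rule max_nrm_nonneg)
  show "\<bar>v j\<bar> \<le> max_nrm n v" if "j < n" using that by (rule abs_le_max_nrm)
  show "max_nrm n u \<le> C * max_nrm n v" if "0 \<le> C" "\<And>j. j < n \<Longrightarrow> \<bar>u j\<bar> \<le> C * \<bar>v j\<bar>"
    unfolding max_nrm_le_iff
  proof (intro conjI allI impI)
    show "0 \<le> C * max_nrm n v" using that(1) by (simp add: max_nrm_nonneg)
    fix i assume "i < n"
    then have "\<bar>u i\<bar> \<le> C * \<bar>v i\<bar>" by (rule that(2))
    also have "\<dots> \<le> C * max_nrm n v" using \<open>i < n\<close> that(1) by (intro mult_left_mono abs_le_max_nrm)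
    finally show "\<bar>u i\<bar> \<le> C * max_nrm n v" .
  qed
  have column: "\<bar>\<Sum>i<n. v i * A i k\<bar> \<le> max_nrm n v * (\<Sum>i<n. \<bar>A i k\<bar>)" for n v k and A :: "nat \<Rightarrow> nat \<Rightarrow> real"
  proof -
    have "\<bar>\<Sum>i<n. v i * A i k\<bar> \<le> (\<Sum>i<n. \<bar>v i * A i k\<bar>)" by (rule sum_abs)
    also have "\<dots> \<le> (\<Sum>i<n. max_nrm n v * \<bar>A i k\<bar>)"
      unfolding abs_mult by (intro sum_mono mult_right_mono abs_le_max_nrm) auto
    finally show ?thesis by (simp add: sum_distrib_left)
  qed
  show "max_nrm m (\<lambda>k. \<Sum>i<n. v i * A i k) \<le> max_nrm n v * col_pen p m n (\<lambda>j i. A i j)"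
    unfolding max_nrm_le_iff
  proof (intro conjI allI impI)
    show "0 \<le> max_nrm n v * col_pen p m n (\<lambda>j i. A i j)" by (simp add: max_nrm_nonneg col_pen_nonneg)
    fix k assume "k < m"
    have "\<bar>\<Sum>i<n. v i * A i k\<bar> \<le> max_nrm n v * (\<Sum>i<n. \<bar>A i k\<bar>)" by (rule column)
    also have "\<dots> \<le> max_nrm n v * col_pen p m n (\<lambda>j i. A i j)"
      unfolding col_pen_def using \<open>k < m\<close> abs_le_lpnorm[OF p0, of k m]
      by (intro mult_left_mono sum_mono max_nrm_nonneg) auto
    finally show "\<bar>\<Sum>i<n. v i * A i k\<bar> \<le> max_nrm n v * col_pen p m n (\<lambda>j i. A i j)" .
  qed
  show "0 \<le> col_pen p m n (\<lambda>j i. A i j)" by (rule col_pen_nonneg)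
  show "\<bar>A i j\<bar> \<le> col_pen p m n (\<lambda>j i. A i j)" if "i < n" "j < m"
    using entry_le_col_pen[OF p0, of j m i n "\<lambda>j i. A i j"] that by simp
  show "col_pen p m n (\<lambda>j i. A i j) = col_pen p m n (\<lambda>j i. B i j)" if "\<And>i j. i < n \<Longrightarrow> j < m \<Longrightarrow> A i j = B i j"
    using that by (intro col_pen_cong) auto
  show "continuous_on UNIV (\<lambda>A. col_pen p m n (\<lambda>j i. A i j))" by (rule continuous_on_col_pen(2)[OF p0])
  show "(\<lambda>n r. n) = (\<lambda>n r :: nat. n :: nat) \<or> (\<lambda>n r. n) = (\<lambda>n r :: nat. r)" by simp
  assume c: "0 < c"
  obtain N where N: "\<And>m r B. r \<le> M \<Longrightarrow> col_pen p m r B \<le> R \<Longrightarrow> N < m \<Longrightarrow> \<exists>j<m. (\<Sum>k<r. \<bar>B j k\<bar>) \<le> c"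
    using light_row_exists[OF p0 c] by metis
  show "\<exists>N. \<forall>n m r A B.
      col_pen p m n (\<lambda>j i. A i j) \<le> R \<and> col_pen p r m (\<lambda>j i. B i j) \<le> R \<and> n \<le> M \<and> N < m \<longrightarrow>
      (\<exists>j<m. \<exists>w\<ge>0.
        (\<forall>x. \<bar>\<Sum>i<n. x i * A i j\<bar> * max_nrm r (B j) \<le> c * w * max_nrm n x) \<and>
        (\<forall>h. bij_betw h {..<m - 1} ({..<m} - {j}) \<longrightarrow>
          col_pen p (m - 1) n (\<lambda>k i. A i (h k)) + col_pen p r (m - 1) (\<lambda>k i. B (h i) k) + w
            \<le> col_pen p m n (\<lambda>j i. A i j) + col_pen p r m (\<lambda>j i. B i j)))"
  proof (rule exI[of _ N], intro allI impI, elim conjE)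
    fix n m r and A B :: "nat \<Rightarrow> nat \<Rightarrow> real"
    assume "col_pen p m n (\<lambda>j i. A i j) \<le> R" "n \<le> M" "N < m"
    \<comment> \<open>The light row is taken in the transpose of \<open>A\<close>, so it is the
      fan-in of unit \<open>j\<close> that is light, while the fan-out \<open>B j\<close> carries
      the penalty \<open>?w\<close>.\<close>
    then obtain j where j: "j < m" "(\<Sum>i<n. \<bar>A i j\<bar>) \<le> c" using N by blast
    let ?w = "lpnorm p r (B j)"
    have B: "max_nrm r (B j) \<le> ?w"
      unfolding max_nrm_le_iff using p0 by (auto simp: lpnorm_nonneg abs_le_lpnorm)
    have "\<bar>\<Sum>i<n. x i * A i j\<bar> * max_nrm r (B j) \<le> (max_nrm n x * c) * ?w" for x
    proof (intro mult_mono B)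
      have "\<bar>\<Sum>i<n. x i * A i j\<bar> \<le> max_nrm n x * (\<Sum>i<n. \<bar>A i j\<bar>)" by (rule column)
      also have "\<dots> \<le> max_nrm n x * c" using j by (intro mult_left_mono max_nrm_nonneg)
      finally show "\<bar>\<Sum>i<n. x i * A i j\<bar> \<le> max_nrm n x * c" .
    qed (use c in \<open>auto simp: max_nrm_nonneg\<close>)
    moreover have "col_pen p (m - 1) n (\<lambda>k i. A i (h k)) + col_pen p r (m - 1) (\<lambda>k i. B (h i) k) + ?w
            \<le> col_pen p m n (\<lambda>j i. A i j) + col_pen p r m (\<lambda>j i. B i j)"
      if "bij_betw h {..<m - 1} ({..<m} - {j})" for h
      using col_pen_delete_column[OF j(1) that, of p r "\<lambda>j i. B i j"]
        col_pen_delete_row[OF p0 that, of n "\<lambda>j i. A i j"] by simp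
    ultimately show "\<exists>j<m. \<exists>w\<ge>0.
        (\<forall>x. \<bar>\<Sum>i<n. x i * A i j\<bar> * max_nrm r (B j) \<le> c * w * max_nrm n x) \<and>
        (\<forall>h. bij_betw h {..<m - 1} ({..<m} - {j}) \<longrightarrow>
          col_pen p (m - 1) n (\<lambda>k i. A i (h k)) + col_pen p r (m - 1) (\<lambda>k i. B (h i) k) + w
            \<le> col_pen p m n (\<lambda>j i. A i j) + col_pen p r m (\<lambda>j i. B i j))"
      using j(1) by (intro exI[of _ j] conjI exI[of _ ?w] allI impI) (simp_all add: lpnorm_nonneg mult_ac)
  qed
qed

section \<open>Relevant coordinates of a network, and recursive bounds on widths\<close>

lemma layer_cong:
  assumes "\<And>l. l \<le> m \<Longrightarrow> d l = d' l"
    and "\<And>l i j. l \<in> {1..m} \<Longrightarrow> i < d (l - 1) \<Longrightarrow> j < d l \<Longrightarrow> W l i j = W' l i j"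
    and "j < d m"
  shows "layer \<sigma> d W x m j = layer \<sigma> d' W' x m j"
  using assms
proof (induction m arbitrary: j)
  case (Suc m)
  have "layer \<sigma> d W x m i * W (Suc m) i j = layer \<sigma> d' W' x m i * W' (Suc m) i j" if "i < d m" for i
    using Suc.IH[of i] Suc.prems(1) Suc.prems(2)[of "Suc m" i j] Suc.prems(2,3) that by fastforce
  then show ?case
    using Suc.prems(1)[of m] by simp
qed simp

lemma widths_bounded:
  fixes nb :: "nat \<Rightarrow> nat \<Rightarrow> nat" and F :: "nat \<Rightarrow> nat \<Rightarrow> nat"
  assumes "nb = (\<lambda>n r. n) \<or> nb = (\<lambda>n r. r)"
  shows "\<exists>b. \<forall>d. d 0 = a \<longrightarrow> d L = z \<longrightarrow> (\<forall>l. 0 < l \<and> l < L \<longrightarrow> d l \<le> F l (nb (d (l - 1)) (d (l + 1))))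
    \<longrightarrow> (\<forall>l\<le>L. d l \<le> (b :: nat))"
proof -
  define P where "P d \<longleftrightarrow> d 0 = a \<and> d L = z \<and> (\<forall>l. 0 < l \<and> l < L \<longrightarrow> d l \<le> F l (nb (d (l - 1)) (d (l + 1))))" for d
  \<comment> \<open>\<open>F l\<close> need not be monotone, so a bound \<open>b\<close> on the
    neighbouring width is passed on through the maximum over all values up to
    \<open>b\<close>.\<close>
  have F_le: "F l k \<le> Max (F l ` {..b})" if "k \<le> b" for l k b
    using that by (intro Max_ge) auto
  have "\<exists>b. \<forall>d. P d \<longrightarrow> d l \<le> b" if "l \<le> L" for l
    using assms
  proof
    assume nb: "nb = (\<lambda>n r. n)"
    show ?thesis
      using that
    proof (induction l)
      case 0
      then show ?case by (auto simp: P_def)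
    next
      case (Suc l)
      then obtain b where b: "\<And>d. P d \<Longrightarrow> d l \<le> b" by auto
      show ?case
      proof (cases "Suc l = L")
        case True
        then show ?thesis by (auto simp: P_def)
      next
        case False
        then have le: "d (Suc l) \<le> F (Suc l) (d l)" if "P d" for d
          using that Suc.prems unfolding P_def nb by (auto dest: spec[of _ "Suc l"])
        have "d (Suc l) \<le> Max (F (Suc l) ` {..b})" if "P d" for d
          using le[OF that] F_le[OF b[OF that]] by (rule order_trans)
        then show ?thesis by blast
      qed
    qed
  next
    assume nb: "nb = (\<lambda>n r. r)"
    show ?thesis
      using that
    proof (induction rule: inc_induct)
      case base
      then show ?case by (auto simp: P_def)
    next
      case (step l)
      then obtain b where b: "\<And>d. P d \<Longrightarrow> d (Suc l) \<le> b" by auto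
      show ?case
      proof (cases "l = 0")
        case True
        then show ?thesis by (auto simp: P_def)
      next
        case False
        then have le: "d l \<le> F l (d (Suc l))" if "P d" for d
          using that step.hyps unfolding P_def nb by auto
        have "d l \<le> Max (F l ` {..b})" if "P d" for d
          using le[OF that] F_le[OF b[OF that]] by (rule order_trans)
        then show ?thesis by blast
      qed
    qed
  qed
  then have "\<forall>l\<in>{..L}. \<exists>b. \<forall>d. P d \<longrightarrow> d l \<le> b" by simp
  then obtain b where b: "\<forall>l\<in>{..L}. \<forall>d. P d \<longrightarrow> d l \<le> b l" by (rule bchoice[THEN exE])
  have "d l \<le> Max (b ` {..L})" if "P d" "l \<le> L" for d l
  proof -
    have "d l \<le> b l" using b that by simp
    also have "\<dots> \<le> Max (b ` {..L})" using that by (intro Max_ge) auto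
    finally show ?thesis .
  qed
  then show ?thesis unfolding P_def by blast
qed

subsection \<open>Width reduction\<close>

text \<open>Tychonoff's theorem. Weights are total functions, hence points of an infinite product
  even when the widths are fixed.\<close>

lemma compact_functions_into:
  assumes "compact S"
  shows "compact {f :: 'a \<Rightarrow> 'b::topological_space. \<forall>i. f i \<in> S}"
proof -
  have "compactin (product_topology (\<lambda>i :: 'a. euclidean) UNIV) (PiE UNIV (\<lambda>_. S))"
    using assms by (subst compactin_PiE) simp
  moreover have "PiE UNIV (\<lambda>_ :: 'a. S) = {f. \<forall>i. f i \<in> S}"
    by auto
  ultimately show ?thesis
    by (simp add: euclidean_product_topology)
qed

lemma continuous_on_weight:
  "continuous_on S (\<lambda>W :: nat \<Rightarrow> nat \<Rightarrow> nat \<Rightarrow> real. W l)"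
  by (rule continuous_on_product_then_coordinatewise[of S "\<lambda>W. W"], rule continuous_on_id)

lemma continuous_on_weight_entry:
  "continuous_on S (\<lambda>W :: nat \<Rightarrow> nat \<Rightarrow> nat \<Rightarrow> real. W l i j)"
  by (rule continuous_on_product_then_coordinatewise[of S "\<lambda>W. W l i"],
      rule continuous_on_product_then_coordinatewise[of S "\<lambda>W. W l"], rule continuous_on_weight)

text \<open>Renumbering the columns entering layer \<open>l\<close> and the rows leaving it by the
  same \<open>h\<close> preserves the activations of the surviving units, so the next pre-activation
  loses exactly the term of unit \<open>j\<close>.\<close>

lemma layer_delete_unit:
  assumes l: "0 < l" and j: "j < d l" and h: "bij_betw h {..<d l - 1} ({..<d l} - {j})"
    and d': "d' = d(l := d l - 1)"
    and W': "W' = W(l := \<lambda>i k. W l i (h k), Suc l := \<lambda>i k. W (Suc l) (h i) k)"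
  shows "m < l \<Longrightarrow> layer \<sigma> d' W' x m = layer \<sigma> d W x m"
    and "layer \<sigma> d' W' x l k = layer \<sigma> d W x l (h k)"
    and "(\<Sum>i<d' l. layer \<sigma> d' W' x l i * W' (Suc l) i k) =
      (\<Sum>i<d l. layer \<sigma> d W x l i * W (Suc l) i k) - layer \<sigma> d W x l j * W (Suc l) j k"
proof -
  show below: "layer \<sigma> d' W' x m = layer \<sigma> d W x m" if "m < l" for m
    using that by (induction m) (auto simp: d' W')
  obtain l' where l': "l = Suc l'"
    using l by (cases l) auto
  show at: "layer \<sigma> d' W' x l k = layer \<sigma> d W x l (h k)" for k
    using below[of l'] by (simp add: l' d' W')
  have "(\<Sum>i<d' l. layer \<sigma> d' W' x l i * W' (Suc l) i k)
      = (\<Sum>i<d l - 1. layer \<sigma> d W x l (h i) * W (Suc l) (h i) k)"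
    by (simp add: at) (simp add: d' W')
  also have "\<dots> = (\<Sum>i\<in>{..<d l} - {j}. layer \<sigma> d W x l i * W (Suc l) i k)"
    using sum.reindex_bij_betw[OF h, of "\<lambda>i. layer \<sigma> d W x l i * W (Suc l) i k"] .
  finally show "(\<Sum>i<d' l. layer \<sigma> d' W' x l i * W' (Suc l) i k) =
      (\<Sum>i<d l. layer \<sigma> d W x l i * W (Suc l) i k) - layer \<sigma> d W x l j * W (Suc l) j k"
    using j by (simp add: sum_diff1)
qed

section \<open>Networks with an abstract penalty covering both regularizers\<close>

locale penalised_network = layer_penalty nrm pen nb
  for nrm :: "nat \<Rightarrow> (nat \<Rightarrow> real) \<Rightarrow> real"
    and pen :: "nat \<Rightarrow> nat \<Rightarrow> (nat \<Rightarrow> nat \<Rightarrow> real) \<Rightarrow> real"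
    and nb :: "nat \<Rightarrow> nat \<Rightarrow> nat" +
  fixes L :: nat
    and D :: "((real^'i::finite) \<times> 'y) set"
    and \<sigma> :: "nat \<Rightarrow> real \<Rightarrow> real"
    and e :: "real^'o::finite \<Rightarrow> 'y \<Rightarrow> real"
    and lam :: real
  assumes depth: "1 \<le> L"
    and finite_data: "finite D"
    and data_nonempty: "D \<noteq> {}"
    and activation: "\<And>l. l \<in> {1..L} \<Longrightarrow> activation_ok (\<sigma> l)"
    and error: "error_ok e"
    and lam_pos: "0 < lam"
begin

definition total :: "(nat \<Rightarrow> nat) \<Rightarrow> (nat \<Rightarrow> nat \<Rightarrow> nat \<Rightarrow> real) \<Rightarrow> real" where
  "total d W = (\<Sum>l\<in>{1..L}. pen (d (l - 1)) (d l) (W l))"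

definition cost :: "(nat \<Rightarrow> nat) \<Rightarrow> (nat \<Rightarrow> nat \<Rightarrow> nat \<Rightarrow> real) \<Rightarrow> real" where
  "cost d W = (\<Sum>(x, y)\<in>D. e (net L \<sigma> d W x) y) / real (card D) + lam * total d W"

lemma total_nonneg: "0 \<le> total d W"
  by (simp add: total_def sum_nonneg pen_nonneg)

lemma pen_le_total: "l \<in> {1..L} \<Longrightarrow> pen (d (l - 1)) (d l) (W l) \<le> total d W"
  unfolding total_def
  by (rule member_le_sum[of l _ "\<lambda>l. pen (d (l - 1)) (d l) (W l)"]) (auto simp: pen_nonneg)

lemma total_le_cost: "lam * total d W \<le> cost d W"
  using error by (auto simp: cost_def error_ok_def intro!: divide_nonneg_nonneg sum_nonneg)

lemma total_le_if_cost_le: "cost d W \<le> C \<Longrightarrow> total d W \<le> C / lam"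
  using total_le_cost[of d W] lam_pos by (simp add: field_simps)

text \<open>Width functions and weights are total; this allows their values outside the network to
  be normalised, which is what makes the candidate sets finite or compact later on.\<close>

lemma cost_cong:
  assumes d: "\<And>l. l \<le> L \<Longrightarrow> d l = d' l"
    and W: "\<And>l i j. l \<in> {1..L} \<Longrightarrow> i < d (l - 1) \<Longrightarrow> j < d l \<Longrightarrow> W l i j = W' l i j"
    and out: "d L = CARD('o)"
  shows "cost d W = cost d' W'"
proof -
  have "layer \<sigma> d W x L j = layer \<sigma> d' W' x L j" if "j < CARD('o)" for x j
    using layer_cong[OF d W] that out by simp
  then have "net L \<sigma> d W x = (net L \<sigma> d' W' x :: real^'o)" for x :: "real^'i"
    by (simp add: net_def vec_eq_iff idx_inv_less)
  moreover have "total d W = total d' W'"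
    unfolding total_def
  proof (rule sum.cong[OF refl])
    fix l assume l: "l \<in> {1..L}"
    have "pen (d (l - 1)) (d l) (W l) = pen (d (l - 1)) (d l) (W' l)"
      using W[OF l] by (rule pen_cong)
    then show "pen (d (l - 1)) (d l) (W l) = pen (d' (l - 1)) (d' l) (W' l)"
      using d[of l] d[of "l - 1"] l by force
  qed
  ultimately show ?thesis
    by (simp add: cost_def)
qed

section \<open>Forward bounds and perturbation estimates independent of the widths\<close>

lemma nrm_preactivation_le:
  assumes "Suc m \<le> L" "total d W \<le> R" "nrm (d m) v \<le> B"
  shows "nrm (d (Suc m)) (\<lambda>k. \<Sum>i<d m. v i * W (Suc m) i k) \<le> B * R"
proof -
  have "nrm (d (Suc m)) (\<lambda>k. \<Sum>i<d m. v i * W (Suc m) i k) \<le> nrm (d m) v * pen (d m) (d (Suc m)) (W (Suc m))"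
    by (rule nrm_mult)
  also have "\<dots> \<le> B * R"
    using pen_le_total[of "Suc m" d W] assms nrm_nonneg[of "d m" v]
    by (intro mult_mono) (auto simp: pen_nonneg)
  finally show ?thesis .
qed

text \<open>Since \<open>\<sigma> l\<close> vanishes at \<open>0\<close>, its local Lipschitz
  constant also bounds its growth, so one \<open>K\<close> serves both purposes.\<close>

lemma activation_uniform:
  assumes "l \<in> {1..L}" "0 \<le> S"
  shows "\<exists>K\<ge>0. (\<forall>t u. \<bar>t\<bar> \<le> S \<longrightarrow> \<bar>u\<bar> \<le> S \<longrightarrow> \<bar>\<sigma> l t - \<sigma> l u\<bar> \<le> K * \<bar>t - u\<bar>) \<and>
    (\<forall>t. \<bar>t\<bar> \<le> S \<longrightarrow> \<bar>\<sigma> l t\<bar> \<le> K * \<bar>t\<bar>)"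
proof -
  obtain K where K: "0 \<le> K" "\<And>t u. \<bar>t\<bar> \<le> S \<Longrightarrow> \<bar>u\<bar> \<le> S \<Longrightarrow> \<bar>\<sigma> l t - \<sigma> l u\<bar> \<le> K * \<bar>t - u\<bar>"
    using activation_lipschitz[OF activation[OF assms(1)] assms(2)] by blast
  have "\<bar>\<sigma> l t\<bar> \<le> K * \<bar>t\<bar>" if "\<bar>t\<bar> \<le> S" for t
    using K(2)[of t 0] that assms(2) activation_zero[OF activation[OF assms(1)]] by simp
  with K show ?thesis by blast
qed

text \<open>The order of quantifiers is the point: \<open>B\<close> is chosen before
  \<open>d\<close>. If layer \<open>m\<close> is bounded by \<open>B\<close>, the next
  pre-activations lie within \<open>B * R\<close>, where the activation grows at most linearly with
  some constant \<open>K\<close>; the new bound is \<open>K * (B * R)\<close>.\<close>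

lemma layer_bounded:
  assumes "m \<le> L" "0 \<le> R" "0 \<le> X"
  shows "\<exists>B\<ge>0. \<forall>d W x. total d W \<le> R \<longrightarrow> nrm (d 0) x \<le> X \<longrightarrow> nrm (d m) (layer \<sigma> d W x m) \<le> B"
  using assms(1)
proof (induction m)
  case 0
  then show ?case using assms(3) by auto
next
  case (Suc m)
  then obtain B where B: "B \<ge> 0"
    "\<And>d W x. total d W \<le> R \<Longrightarrow> nrm (d 0) x \<le> X \<Longrightarrow> nrm (d m) (layer \<sigma> d W x m) \<le> B"
    by auto
  have S: "0 \<le> B * R" using B assms by simp
  have mem: "Suc m \<in> {1..L}" using Suc.prems by simp
  obtain K where K: "0 \<le> K"
    "\<forall>t u. \<bar>t\<bar> \<le> B * R \<longrightarrow> \<bar>u\<bar> \<le> B * R \<longrightarrow> \<bar>\<sigma> (Suc m) t - \<sigma> (Suc m) u\<bar> \<le> K * \<bar>t - u\<bar>"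
    "\<forall>t. \<bar>t\<bar> \<le> B * R \<longrightarrow> \<bar>\<sigma> (Suc m) t\<bar> \<le> K * \<bar>t\<bar>"
    using activation_uniform[OF mem S] by blast
  have "nrm (d (Suc m)) (layer \<sigma> d W x (Suc m)) \<le> K * (B * R)"
    if t: "total d W \<le> R" and x: "nrm (d 0) x \<le> X" for d W x
  proof -
    let ?z = "\<lambda>k. \<Sum>i<d m. layer \<sigma> d W x m i * W (Suc m) i k"
    have z: "nrm (d (Suc m)) ?z \<le> B * R"
      using nrm_preactivation_le[OF Suc.prems t B(2)[OF t x]] .
    have "nrm (d (Suc m)) (layer \<sigma> d W x (Suc m)) \<le> K * nrm (d (Suc m)) ?z"
    proof (rule nrm_dominated[OF K(1)])
      fix j assume "j < d (Suc m)"
      then have "\<bar>?z j\<bar> \<le> B * R"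
        using abs_le_nrm[of j "d (Suc m)" ?z] z by linarith
      then show "\<bar>layer \<sigma> d W x (Suc m) j\<bar> \<le> K * \<bar>?z j\<bar>"
        using K(3) by simp
    qed
    also have "\<dots> \<le> K * (B * R)"
      using z K(1) by (rule mult_left_mono)
    finally show ?thesis .
  qed
  then show ?case
    using K(1) S by (intro exI[of _ "K * (B * R)"]) auto
qed

text \<open>The pre-activations of both networks lie in the same interval, so a single local
  Lipschitz constant applies. The widths \<open>d m\<close> and \<open>d' m\<close> may differ, as
  they do after a deletion in layer \<open>m\<close>.\<close>

lemma nrm_activation_diff_le:
  assumes m: "Suc m \<le> L" and "0 \<le> R" "0 \<le> X"
  shows "\<exists>K\<ge>0. \<forall>d W d' W' x. total d W \<le> R \<longrightarrow> total d' W' \<le> R \<longrightarrow> nrm (d 0) x \<le> X \<longrightarrow>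
    d' 0 = d 0 \<longrightarrow> d' (Suc m) = d (Suc m) \<longrightarrow>
    nrm (d (Suc m)) (\<lambda>k. layer \<sigma> d' W' x (Suc m) k - layer \<sigma> d W x (Suc m) k)
      \<le> K * nrm (d (Suc m)) (\<lambda>k. (\<Sum>i<d' m. layer \<sigma> d' W' x m i * W' (Suc m) i k)
          - (\<Sum>i<d m. layer \<sigma> d W x m i * W (Suc m) i k))"
proof -
  obtain B where B: "B \<ge> 0"
    "\<And>d W x. total d W \<le> R \<Longrightarrow> nrm (d 0) x \<le> X \<Longrightarrow> nrm (d m) (layer \<sigma> d W x m) \<le> B"
    using layer_bounded[of m R X] assms by (auto simp: Suc_le_eq)
  have S: "0 \<le> B * R" using B assms by simp
  have mem: "Suc m \<in> {1..L}" using m by simp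
  obtain K where K: "0 \<le> K"
    "\<forall>t u. \<bar>t\<bar> \<le> B * R \<longrightarrow> \<bar>u\<bar> \<le> B * R \<longrightarrow> \<bar>\<sigma> (Suc m) t - \<sigma> (Suc m) u\<bar> \<le> K * \<bar>t - u\<bar>"
    "\<forall>t. \<bar>t\<bar> \<le> B * R \<longrightarrow> \<bar>\<sigma> (Suc m) t\<bar> \<le> K * \<bar>t\<bar>"
    using activation_uniform[OF mem S] by blast
  have z: "\<bar>\<Sum>i<d m. layer \<sigma> d W x m i * W (Suc m) i k\<bar> \<le> B * R"
    if "total d W \<le> R" "nrm (d 0) x \<le> X" "k < d (Suc m)" for d W x k
    using nrm_preactivation_le[OF m that(1) B(2)[OF that(1,2)]]
      abs_le_nrm[OF that(3), of "\<lambda>k. \<Sum>i<d m. layer \<sigma> d W x m i * W (Suc m) i k"] by linarith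
  have "nrm (d (Suc m)) (\<lambda>k. layer \<sigma> d' W' x (Suc m) k - layer \<sigma> d W x (Suc m) k)
      \<le> K * nrm (d (Suc m)) (\<lambda>k. (\<Sum>i<d' m. layer \<sigma> d' W' x m i * W' (Suc m) i k)
          - (\<Sum>i<d m. layer \<sigma> d W x m i * W (Suc m) i k))"
    if "total d W \<le> R" "total d' W' \<le> R" "nrm (d 0) x \<le> X" "d' 0 = d 0" "d' (Suc m) = d (Suc m)"
    for d W d' W' x
    unfolding layer.simps
  proof (rule nrm_dominated[OF K(1)])
    fix k assume k: "k < d (Suc m)"
    show "\<bar>\<sigma> (Suc m) (\<Sum>i<d' m. layer \<sigma> d' W' x m i * W' (Suc m) i k)
        - \<sigma> (Suc m) (\<Sum>i<d m. layer \<sigma> d W x m i * W (Suc m) i k)\<bar>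
      \<le> K * \<bar>(\<Sum>i<d' m. layer \<sigma> d' W' x m i * W' (Suc m) i k)
        - (\<Sum>i<d m. layer \<sigma> d W x m i * W (Suc m) i k)\<bar>"
      using K(2) z[OF that(1,3) k] z[OF that(2), of x k] that k by simp
  qed
  then show ?thesis
    using K(1) by blast
qed

text \<open>Beyond layer \<open>q\<close> both networks use the same weights, so a discrepancy at
  \<open>q\<close> is multiplied in each layer by at most an activation constant times
  \<open>R\<close>.\<close>

lemma layer_lipschitz:
  assumes "q \<le> m" "m \<le> L" "0 \<le> R" "0 \<le> X"
  shows "\<exists>K\<ge>0. \<forall>d W d' W' x. total d W \<le> R \<longrightarrow> total d' W' \<le> R \<longrightarrow> nrm (d 0) x \<le> X \<longrightarrow>
    d' 0 = d 0 \<longrightarrow> (\<forall>k\<ge>q. d' k = d k) \<longrightarrow> (\<forall>k>q. W' k = W k) \<longrightarrow>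
    nrm (d m) (\<lambda>k. layer \<sigma> d' W' x m k - layer \<sigma> d W x m k)
      \<le> K * nrm (d q) (\<lambda>k. layer \<sigma> d' W' x q k - layer \<sigma> d W x q k)"
  using assms(1,2)
proof (induction rule: dec_induct)
  case base
  then show ?case by (intro exI[of _ 1]) auto
next
  case (step m)
  then obtain K where K: "K \<ge> 0"
    "\<And>d W d' W' x. total d W \<le> R \<Longrightarrow> total d' W' \<le> R \<Longrightarrow> nrm (d 0) x \<le> X \<Longrightarrow>
      d' 0 = d 0 \<Longrightarrow> (\<forall>k\<ge>q. d' k = d k) \<Longrightarrow> (\<forall>k>q. W' k = W k) \<Longrightarrow>
      nrm (d m) (\<lambda>k. layer \<sigma> d' W' x m k - layer \<sigma> d W x m k)
      \<le> K * nrm (d q) (\<lambda>k. layer \<sigma> d' W' x q k - layer \<sigma> d W x q k)"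
    by auto
  obtain K' where K': "K' \<ge> 0"
    "\<And>d W d' W' x. total d W \<le> R \<Longrightarrow> total d' W' \<le> R \<Longrightarrow> nrm (d 0) x \<le> X \<Longrightarrow>
    d' 0 = d 0 \<Longrightarrow> d' (Suc m) = d (Suc m) \<Longrightarrow>
    nrm (d (Suc m)) (\<lambda>k. layer \<sigma> d' W' x (Suc m) k - layer \<sigma> d W x (Suc m) k)
      \<le> K' * nrm (d (Suc m)) (\<lambda>k. (\<Sum>i<d' m. layer \<sigma> d' W' x m i * W' (Suc m) i k)
          - (\<Sum>i<d m. layer \<sigma> d W x m i * W (Suc m) i k))"
    using nrm_activation_diff_le[OF step.prems assms(3,4)] by auto
  have "nrm (d (Suc m)) (\<lambda>k. layer \<sigma> d' W' x (Suc m) k - layer \<sigma> d W x (Suc m) k)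
      \<le> K' * (K * R) * nrm (d q) (\<lambda>k. layer \<sigma> d' W' x q k - layer \<sigma> d W x q k)"
    if t: "total d W \<le> R" "total d' W' \<le> R" and x: "nrm (d 0) x \<le> X" and d0: "d' 0 = d 0"
      and d: "\<forall>k\<ge>q. d' k = d k" and W: "\<forall>k>q. W' k = W k" for d W d' W' x
  proof -
    let ?\<Delta> = "\<lambda>m k. layer \<sigma> d' W' x m k - layer \<sigma> d W x m k"
    have eq: "d' m = d m" "d' (Suc m) = d (Suc m)" "W' (Suc m) = W (Suc m)"
      using d W step.hyps by auto
    have "nrm (d (Suc m)) (?\<Delta> (Suc m)) \<le> K' * nrm (d (Suc m))
      (\<lambda>k. (\<Sum>i<d' m. layer \<sigma> d' W' x m i * W' (Suc m) i k) - (\<Sum>i<d m. layer \<sigma> d W x m i * W (Suc m) i k))"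
      by (rule K'(2)[OF t x d0 eq(2)])
    also have "\<dots> = K' * nrm (d (Suc m)) (\<lambda>k. \<Sum>i<d m. ?\<Delta> m i * W (Suc m) i k)"
      unfolding eq by (simp add: left_diff_distrib sum_subtractf)
    also have "\<dots> \<le> K' * (K * nrm (d q) (?\<Delta> q) * R)"
      using nrm_preactivation_le[OF step.prems t(1) K(2)[OF t x d0 d W]] K'(1)
      by (intro mult_left_mono)
    finally show ?thesis by (simp add: mult_ac)
  qed
  then show ?case
    using K K' assms by (intro exI[of _ "K' * (K * R)"]) auto
qed

lemma norm_net_diff_le:
  fixes \<delta> :: real
  assumes "d L = CARD('o)"
    and "nrm (d L) (\<lambda>k. layer \<sigma> d' W' (\<lambda>j. x $ idx j) L k - layer \<sigma> d W (\<lambda>j. x $ idx j) L k) \<le> \<delta>"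
  shows "norm (net L \<sigma> d' W' (x :: real^'i) - net L \<sigma> d W x :: real^'o) \<le> CARD('o) * \<delta>"
proof -
  have "\<bar>(net L \<sigma> d' W' x - net L \<sigma> d W x :: real^'o) $ k\<bar> \<le> \<delta>" for k
    using abs_le_nrm[of "idx_inv k" "d L"
        "\<lambda>k. layer \<sigma> d' W' (\<lambda>j. x $ idx j) L k - layer \<sigma> d W (\<lambda>j. x $ idx j) L k"]
      assms idx_inv_less[of k] by (simp add: net_def)
  then have "(\<Sum>k\<in>UNIV. \<bar>(net L \<sigma> d' W' x - net L \<sigma> d W x :: real^'o) $ k\<bar>) \<le> (\<Sum>k\<in>(UNIV :: 'o set). \<delta>)"
    by (rule sum_mono)
  then show ?thesis
    using norm_le_l1_cart[of "net L \<sigma> d' W' x - net L \<sigma> d W x :: real^'o"] by simp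
qed

lemma norm_net_le:
  fixes B :: real
  assumes "d L = CARD('o)" "nrm (d L) (layer \<sigma> d W (\<lambda>j. x $ idx j) L) \<le> B"
  shows "norm (net L \<sigma> d W (x :: real^'i) :: real^'o) \<le> CARD('o) * B"
proof -
  have "\<bar>(net L \<sigma> d W x :: real^'o) $ k\<bar> \<le> B" for k
    using abs_le_nrm[of "idx_inv k" "d L" "layer \<sigma> d W (\<lambda>j. x $ idx j) L"]
      assms idx_inv_less[of k] by (simp add: net_def)
  then have "(\<Sum>k\<in>UNIV. \<bar>(net L \<sigma> d W x :: real^'o) $ k\<bar>) \<le> (\<Sum>k\<in>(UNIV :: 'o set). B)"
    by (rule sum_mono)
  then show ?thesis
    using norm_le_l1_cart[of "net L \<sigma> d W x :: real^'o"] by simp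
qed

lemma inputs_bounded: "\<exists>X\<ge>0. \<forall>(x, y)\<in>D. nrm CARD('i) (\<lambda>j. x $ idx j) \<le> X"
proof (intro exI[of _ "\<Sum>(x, y)\<in>D. nrm CARD('i) (\<lambda>j. x $ idx j)"] conjI ballI)
  show "0 \<le> (\<Sum>(x, y)\<in>D. nrm CARD('i) (\<lambda>j. x $ idx j))"
    by (auto intro!: sum_nonneg simp: nrm_nonneg)
  show "case z of (x, y) \<Rightarrow> nrm CARD('i) (\<lambda>j. x $ idx j) \<le> (\<Sum>(x, y)\<in>D. nrm CARD('i) (\<lambda>j. x $ idx j))"
    if "z \<in> D" for z
    using member_le_sum[OF that, of "\<lambda>(x, y). nrm CARD('i) (\<lambda>j. x $ idx j)"] finite_data
    by (auto simp: nrm_nonneg split: prod.splits)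
qed

text \<open>The penalty bound keeps both outputs in one fixed ball, so the Lipschitz constant of
  \<open>e\<close> on that ball can be combined with the propagation constant from layer
  \<open>q\<close> to the output.\<close>

lemma error_change_le:
  assumes "q \<le> L" "0 \<le> R"
  shows "\<exists>K\<ge>0. \<forall>d W d' W' x y. (x, y) \<in> D \<longrightarrow> admissible L CARD('i) CARD('o) d \<longrightarrow> total d W \<le> R \<longrightarrow> total d' W' \<le> R \<longrightarrow>
    d' 0 = d 0 \<longrightarrow> (\<forall>k\<ge>q. d' k = d k) \<longrightarrow> (\<forall>k>q. W' k = W k) \<longrightarrow>
    e (net L \<sigma> d' W' x) y \<le> e (net L \<sigma> d W x) y
      + K * nrm (d q) (\<lambda>k. layer \<sigma> d' W' (\<lambda>j. x $ idx j) q k - layer \<sigma> d W (\<lambda>j. x $ idx j) q k)"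
proof -
  obtain X where X: "0 \<le> X" "\<forall>(x, y)\<in>D. nrm CARD('i) (\<lambda>j. x $ idx j) \<le> X"
    using inputs_bounded by blast
  obtain B where B: "0 \<le> B"
    "\<forall>d W x. total d W \<le> R \<longrightarrow> nrm (d 0) x \<le> X \<longrightarrow> nrm (d L) (layer \<sigma> d W x L) \<le> B"
    using layer_bounded[OF order_refl assms(2) X(1)] by blast
  obtain K where K: "0 \<le> K" "\<forall>d W d' W' x. total d W \<le> R \<longrightarrow> total d' W' \<le> R \<longrightarrow> nrm (d 0) x \<le> X \<longrightarrow>
    d' 0 = d 0 \<longrightarrow> (\<forall>k\<ge>q. d' k = d k) \<longrightarrow> (\<forall>k>q. W' k = W k) \<longrightarrow>
    nrm (d L) (\<lambda>k. layer \<sigma> d' W' x L k - layer \<sigma> d W x L k)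
      \<le> K * nrm (d q) (\<lambda>k. layer \<sigma> d' W' x q k - layer \<sigma> d W x q k)"
    using layer_lipschitz[OF assms(1) order_refl assms(2) X(1)] by blast
  obtain E where E: "0 \<le> E" "\<And>u v y. y \<in> snd ` D \<Longrightarrow> norm u \<le> CARD('o) * B \<Longrightarrow> norm v \<le> CARD('o) * B
      \<Longrightarrow> \<bar>e u y - e v y\<bar> \<le> E * norm (u - v)"
    using error_lipschitz[OF error, of "snd ` D" "CARD('o) * B"] finite_data by blast
  have "e (net L \<sigma> d' W' x) y \<le> e (net L \<sigma> d W x) y
      + E * CARD('o) * K * nrm (d q) (\<lambda>k. layer \<sigma> d' W' (\<lambda>j. x $ idx j) q k - layer \<sigma> d W (\<lambda>j. x $ idx j) q k)"
    if xy: "(x, y) \<in> D" and d: "admissible L CARD('i) CARD('o) d" and t: "total d W \<le> R" "total d' W' \<le> R" and d': "d' 0 = d 0"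
      "\<forall>k\<ge>q. d' k = d k" and W': "\<forall>k>q. W' k = W k" for d W d' W' x y
  proof -
    let ?x = "\<lambda>j. x $ idx j"
    let ?\<Delta> = "nrm (d q) (\<lambda>k. layer \<sigma> d' W' ?x q k - layer \<sigma> d W ?x q k)"
    have dims: "d 0 = CARD('i)" "d L = CARD('o)" "d' L = CARD('o)"
      using d d'(2) assms(1) by (auto simp: admissible_def)
    have x: "nrm (d 0) ?x \<le> X" "nrm (d' 0) ?x \<le> X"
      using X(2) xy d'(1) dims by auto
    have "nrm (d L) (\<lambda>k. layer \<sigma> d' W' ?x L k - layer \<sigma> d W ?x L k) \<le> K * ?\<Delta>"
      using K(2) t x(1) d' W' by blast
    then have "norm (net L \<sigma> d' W' x - net L \<sigma> d W x :: real^'o) \<le> CARD('o) * (K * ?\<Delta>)"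
      using dims(2) by (intro norm_net_diff_le)
    moreover have "\<bar>e (net L \<sigma> d' W' x) y - e (net L \<sigma> d W x) y\<bar>
        \<le> E * norm (net L \<sigma> d' W' x - net L \<sigma> d W x :: real^'o)"
    proof (rule E(2))
      show "y \<in> snd ` D" using xy by force
      show "norm (net L \<sigma> d' W' x :: real^'o) \<le> CARD('o) * B"
        using B(2) t(2) x(2) dims(3) by (intro norm_net_le) blast+
      show "norm (net L \<sigma> d W x :: real^'o) \<le> CARD('o) * B"
        using B(2) t(1) x(1) dims(2) by (intro norm_net_le) blast+
    qed
    ultimately have "\<bar>e (net L \<sigma> d' W' x) y - e (net L \<sigma> d W x) y\<bar> \<le> E * (CARD('o) * (K * ?\<Delta>))"
      using E(1) by (meson mult_left_mono order_trans)
    then show ?thesis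
      by (simp add: mult_ac)
  qed
  then show ?thesis
    using E(1) K(1) by (intro exI[of _ "E * CARD('o) * K"]) auto
qed

section \<open>Deletion of hidden units and its iteration\<close>

lemma total_delete_unit:
  assumes l: "0 < l" "l < L"
    and d': "d' = d(l := d l - 1)"
    and W': "W' = W(l := \<lambda>i k. W l i (h k), Suc l := \<lambda>i k. W (Suc l) (h i) k)"
    and pens: "pen (d (l - 1)) (d l - 1) (\<lambda>i k. W l i (h k)) + pen (d l - 1) (d (l + 1)) (\<lambda>i k. W (l + 1) (h i) k) + w
            \<le> pen (d (l - 1)) (d l) (W l) + pen (d l) (d (l + 1)) (W (l + 1))"
  shows "total d' W' + w \<le> total d W"
proof -
  let ?T = "{1..L} - {l, Suc l}"
  have split: "(\<Sum>k\<in>{1..L}. f k) = f l + f (Suc l) + (\<Sum>k\<in>?T. f k)" for f :: "nat \<Rightarrow> real"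
    using sum.subset_diff[of "{l, Suc l}" "{1..L}" f] l by simp
  have "(\<Sum>k\<in>?T. pen (d' (k - 1)) (d' k) (W' k)) = (\<Sum>k\<in>?T. pen (d (k - 1)) (d k) (W k))"
  proof (rule sum.cong[OF refl])
    fix k assume "k \<in> ?T"
    then have "k \<noteq> l" "k - 1 \<noteq> l" "k \<noteq> Suc l" by auto
    then show "pen (d' (k - 1)) (d' k) (W' k) = pen (d (k - 1)) (d k) (W k)"
      by (simp add: d' W')
  qed
  moreover have "pen (d' (l - 1)) (d' l) (W' l) = pen (d (l - 1)) (d l - 1) (\<lambda>i k. W l i (h k))"
    using l by (cases l) (simp_all add: d' W')
  moreover have "pen (d' (Suc l - 1)) (d' (Suc l)) (W' (Suc l)) = pen (d l - 1) (d (l + 1)) (\<lambda>i k. W (l + 1) (h i) k)"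
    by (simp add: d' W')
  ultimately show ?thesis
    unfolding total_def split using pens by simp
qed

lemma wide_layer_reducible:
  assumes l: "0 < l" "l < L" and R: "0 \<le> R"
  shows "\<exists>N. \<forall>d W. admissible L CARD('i) CARD('o) d \<longrightarrow> total d W \<le> R \<longrightarrow> nb (d (l - 1)) (d (l + 1)) \<le> M \<longrightarrow> N < d l \<longrightarrow>
    (\<exists>W'. cost (d(l := d l - 1)) W' \<le> cost d W)"
proof -
  obtain X where X: "0 \<le> X" "\<forall>(x, y)\<in>D. nrm CARD('i) (\<lambda>j. x $ idx j) \<le> X"
    using inputs_bounded by blast
  obtain B where B: "0 \<le> B"
    "\<forall>d W x. total d W \<le> R \<longrightarrow> nrm (d 0) x \<le> X \<longrightarrow> nrm (d (l - 1)) (layer \<sigma> d W x (l - 1)) \<le> B"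
    using layer_bounded[OF less_imp_le R X(1), of "l - 1"] l by (metis less_imp_diff_less)
  have "0 \<le> B * R" using B R by simp
  then obtain K1 where K1: "0 \<le> K1" "\<forall>t. \<bar>t\<bar> \<le> B * R \<longrightarrow> \<bar>\<sigma> l t\<bar> \<le> K1 * \<bar>t\<bar>"
    using activation_uniform[of l "B * R"] l by auto
  have sl: "Suc l \<le> L" using l by simp
  obtain K2 where K2: "0 \<le> K2" "\<forall>d W d' W' x. total d W \<le> R \<longrightarrow> total d' W' \<le> R \<longrightarrow> nrm (d 0) x \<le> X \<longrightarrow>
    d' 0 = d 0 \<longrightarrow> d' (Suc l) = d (Suc l) \<longrightarrow>
    nrm (d (Suc l)) (\<lambda>k. layer \<sigma> d' W' x (Suc l) k - layer \<sigma> d W x (Suc l) k)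
      \<le> K2 * nrm (d (Suc l)) (\<lambda>k. (\<Sum>i<d' l. layer \<sigma> d' W' x l i * W' (Suc l) i k)
          - (\<Sum>i<d l. layer \<sigma> d W x l i * W (Suc l) i k))"
    using nrm_activation_diff_le[OF sl R X(1)] by blast
  obtain K3 where K3: "0 \<le> K3" "\<forall>d W d' W' x y. (x, y) \<in> D \<longrightarrow> admissible L CARD('i) CARD('o) d \<longrightarrow> total d W \<le> R \<longrightarrow> total d' W' \<le> R \<longrightarrow>
    d' 0 = d 0 \<longrightarrow> (\<forall>k\<ge>Suc l. d' k = d k) \<longrightarrow> (\<forall>k>Suc l. W' k = W k) \<longrightarrow>
    e (net L \<sigma> d' W' x) y \<le> e (net L \<sigma> d W x) y
      + K3 * nrm (d (Suc l)) (\<lambda>k. layer \<sigma> d' W' (\<lambda>j. x $ idx j) (Suc l) k - layer \<sigma> d W (\<lambda>j. x $ idx j) (Suc l) k)"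
    using error_change_le[OF sl R] by blast
  \<comment> \<open>The factors along the path of the perturbation: \<open>B\<close> bounds layer
    \<open>l - 1\<close>, \<open>K1\<close> and \<open>K2\<close> come from the activations of
    layers \<open>l\<close> and \<open>Suc l\<close>, and \<open>K3\<close> carries the change in
    layer \<open>Suc l\<close> to the error.\<close>
  define Q where "Q = K3 * (K2 * (K1 * B))"
  have Q: "0 \<le> Q" using B K1 K2 K3 by (simp add: Q_def)
  \<comment> \<open>Small enough for \<open>Q * c \<le> lam\<close>, so that the saved penalty pays
    for the error; \<open>Q + 1\<close> covers \<open>Q = 0\<close>.\<close>
  define c where "c = lam / (Q + 1)"
  have c: "0 < c" "Q * c \<le> lam" using Q lam_pos by (auto simp: c_def field_simps)
  obtain N where N: "\<forall>n m r A B.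
      pen n m A \<le> R \<and> pen m r B \<le> R \<and> nb n r \<le> M \<and> N < m \<longrightarrow>
      (\<exists>j<m. \<exists>w\<ge>0.
        (\<forall>x. \<bar>\<Sum>i<n. x i * A i j\<bar> * nrm r (B j) \<le> c * w * nrm n x) \<and>
        (\<forall>h. bij_betw h {..<m - 1} ({..<m} - {j}) \<longrightarrow>
          pen n (m - 1) (\<lambda>i k. A i (h k)) + pen (m - 1) r (\<lambda>i k. B (h i) k) + w
            \<le> pen n m A + pen m r B))"
    using removal[OF c(1), of R M] by blast
  have "\<exists>W'. cost (d(l := d l - 1)) W' \<le> cost d W"
    if adm: "admissible L CARD('i) CARD('o) d" and t: "total d W \<le> R" and nb: "nb (d (l - 1)) (d (l + 1)) \<le> M" and m: "N < d l" for d W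
  proof -
    have "pen (d (l - 1)) (d l) (W l) \<le> R" "pen (d l) (d (l + 1)) (W (l + 1)) \<le> R"
      using pen_le_total[of l d W] pen_le_total[of "Suc l" d W] t l by auto
    with N nb m obtain j w where j: "j < d l" and w: "w \<ge> 0"
      and light: "\<forall>x. \<bar>\<Sum>i<d (l - 1). x i * W l i j\<bar> * nrm (d (l + 1)) (W (l + 1) j) \<le> c * w * nrm (d (l - 1)) x"
      and saved: "\<forall>h. bij_betw h {..<d l - 1} ({..<d l} - {j}) \<longrightarrow>
          pen (d (l - 1)) (d l - 1) (\<lambda>i k. W l i (h k)) + pen (d l - 1) (d (l + 1)) (\<lambda>i k. W (l + 1) (h i) k) + w
            \<le> pen (d (l - 1)) (d l) (W l) + pen (d l) (d (l + 1)) (W (l + 1))"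
      by blast
    have "\<exists>h. bij_betw h {..<d l - 1} ({..<d l} - {j})"
      using ex_bij_betw_nat_finite[of "{..<d l} - {j}"] j by (simp add: atLeast0LessThan)
    then obtain h where h: "bij_betw h {..<d l - 1} ({..<d l} - {j})" by blast
    define d' where "d' = d(l := d l - 1)"
    define W' where "W' = W(l := \<lambda>i k. W l i (h k), Suc l := \<lambda>i k. W (Suc l) (h i) k)"
    have tw: "total d' W' + w \<le> total d W"
      using total_delete_unit[OF l d'_def W'_def] saved h by blast
    \<comment> \<open>The reduced network obeys the same penalty bound, so the constants fixed above
      apply to it as well.\<close>
    then have t': "total d' W' \<le> R" using t w by linarith
    have agree: "d' 0 = d 0" "\<forall>k\<ge>Suc l. d' k = d k" "\<forall>k>Suc l. W' k = W k" "d' (Suc l) = d (Suc l)"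
      using l by (auto simp: d'_def W'_def)
    have err: "e (net L \<sigma> d' W' x) y \<le> e (net L \<sigma> d W x) y + lam * w" if xy: "(x, y) \<in> D" for x y
    proof -
      let ?x = "\<lambda>j. x $ idx j"
      let ?r = "d (Suc l)" and ?a = "layer \<sigma> d W ?x l j"
      let ?z = "\<Sum>i<d (l - 1). layer \<sigma> d W ?x (l - 1) i * W l i j"
      have x: "nrm (d 0) ?x \<le> X"
        using X(2) xy adm by (auto simp: admissible_def)
      have b: "nrm (d (l - 1)) (layer \<sigma> d W ?x (l - 1)) \<le> B"
        using B(2) t x by blast
      have a: "?a = \<sigma> l ?z"
        using l by (cases l) auto
      have "\<bar>?z\<bar> \<le> B * R"
        using nrm_preactivation_le[of "l - 1" d W R, OF _ t b] l
          abs_le_nrm[OF j, of "\<lambda>k. \<Sum>i<d (l - 1). layer \<sigma> d W ?x (l - 1) i * W l i k"] by simp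
      then have a': "\<bar>?a\<bar> \<le> K1 * \<bar>?z\<bar>"
        using K1(2) a by simp
      have "nrm ?r (\<lambda>k. layer \<sigma> d' W' ?x (Suc l) k - layer \<sigma> d W ?x (Suc l) k)
        \<le> K2 * nrm ?r (\<lambda>k. (\<Sum>i<d' l. layer \<sigma> d' W' ?x l i * W' (Suc l) i k)
          - (\<Sum>i<d l. layer \<sigma> d W ?x l i * W (Suc l) i k))"
        using K2(2) t t' x agree by blast
      also have "\<dots> = K2 * nrm ?r (\<lambda>k. - (?a * W (Suc l) j k))"
        by (simp add: layer_delete_unit(3)[OF l(1) j h d'_def W'_def])
      also have "\<dots> \<le> K2 * (\<bar>?a\<bar> * nrm ?r (W (Suc l) j))"
        by (intro mult_left_mono K2(1) nrm_dominated) (auto simp: abs_mult)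
      also have "\<dots> \<le> K2 * (K1 * (\<bar>?z\<bar> * nrm ?r (W (Suc l) j)))"
        using mult_right_mono[OF a' nrm_nonneg[of ?r "W (Suc l) j"]]
        by (intro mult_left_mono K2(1)) (simp add: mult_ac)
      also have "\<dots> \<le> K2 * (K1 * (c * w * B))"
      proof (intro mult_left_mono K1(1) K2(1))
        have "\<bar>?z\<bar> * nrm ?r (W (Suc l) j) \<le> c * w * nrm (d (l - 1)) (layer \<sigma> d W ?x (l - 1))"
          using light by simp
        also have "\<dots> \<le> c * w * B"
          using b c w by (intro mult_left_mono) auto
        finally show "\<bar>?z\<bar> * nrm ?r (W (Suc l) j) \<le> c * w * B" .
      qed
      finally have \<Delta>: "nrm ?r (\<lambda>k. layer \<sigma> d' W' ?x (Suc l) k - layer \<sigma> d W ?x (Suc l) k) \<le> K2 * (K1 * (c * w * B))" .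
      have "e (net L \<sigma> d' W' x) y \<le> e (net L \<sigma> d W x) y
        + K3 * nrm ?r (\<lambda>k. layer \<sigma> d' W' ?x (Suc l) k - layer \<sigma> d W ?x (Suc l) k)"
        using K3(2) xy adm t t' agree by blast
      also have "\<dots> \<le> e (net L \<sigma> d W x) y + K3 * (K2 * (K1 * (c * w * B)))"
        using mult_left_mono[OF \<Delta> K3(1)] by simp
      also have "\<dots> = e (net L \<sigma> d W x) y + (Q * c) * w"
        by (simp add: Q_def mult_ac)
      also have "\<dots> \<le> e (net L \<sigma> d W x) y + lam * w"
        using mult_right_mono[OF c(2) w] by simp
      finally show ?thesis .
    qed
    have "(\<Sum>(x, y)\<in>D. e (net L \<sigma> d' W' x) y) \<le> (\<Sum>(x, y)\<in>D. e (net L \<sigma> d W x) y + lam * w)"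
      using err by (intro sum_mono) auto
    also have "\<dots> = (\<Sum>(x, y)\<in>D. e (net L \<sigma> d W x) y) + card D * (lam * w)"
      by (simp add: sum.distrib case_prod_unfold)
    finally have "(\<Sum>(x, y)\<in>D. e (net L \<sigma> d' W' x) y) / card D
        \<le> ((\<Sum>(x, y)\<in>D. e (net L \<sigma> d W x) y) + card D * (lam * w)) / card D"
      by (rule divide_right_mono) simp
    also have "\<dots> = (\<Sum>(x, y)\<in>D. e (net L \<sigma> d W x) y) / card D + lam * w"
      using finite_data data_nonempty by (simp add: add_divide_distrib)
    finally have "cost d' W' \<le> (\<Sum>(x, y)\<in>D. e (net L \<sigma> d W x) y) / card D + lam * (total d' W' + w)"
      by (simp add: cost_def algebra_simps)
    also have "\<dots> \<le> cost d W"
      using mult_left_mono[OF tw, of lam] lam_pos by (simp add: cost_def)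
    finally show ?thesis
      unfolding d'_def by blast
  qed
  then show ?thesis by blast
qed

lemma reducible_to_bounded_width:
  "\<exists>b. \<forall>d W. admissible L CARD('i) CARD('o) d \<longrightarrow> cost d W \<le> C \<longrightarrow>
    (\<exists>d' W'. admissible L CARD('i) CARD('o) d' \<and> (\<forall>l\<le>L. d' l \<le> b) \<and> cost d' W' \<le> cost d W)"
proof (cases "0 \<le> C")
  \<comment> \<open>Costs are nonnegative, so a negative level \<open>C\<close> admits no network at
    all.\<close>
  case False
  then have "\<not> cost d W \<le> C" for d W
    using total_le_cost[of d W] mult_nonneg_nonneg[of lam "total d W"] total_nonneg[of d W] lam_pos
    by linarith
  then show ?thesis by blast
next
  case True
  then have R: "0 \<le> C / lam" using lam_pos by simp
  have "\<exists>N. 0 < l \<and> l < L \<longrightarrow> (\<forall>d W. admissible L CARD('i) CARD('o) d \<longrightarrow> total d W \<le> C / lam \<longrightarrow>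
    nb (d (l - 1)) (d (l + 1)) \<le> M \<longrightarrow> N < d l \<longrightarrow> (\<exists>W'. cost (d(l := d l - 1)) W' \<le> cost d W))" for l M
    using wide_layer_reducible[OF _ _ R, of l M] by blast
  then obtain N where N: "\<And>l M d W. 0 < l \<Longrightarrow> l < L \<Longrightarrow> admissible L CARD('i) CARD('o) d \<Longrightarrow> total d W \<le> C / lam \<Longrightarrow>
    nb (d (l - 1)) (d (l + 1)) \<le> M \<Longrightarrow> N l M < d l \<Longrightarrow> (\<exists>W'. cost (d(l := d l - 1)) W' \<le> cost d W)"
    by metis
  \<comment> \<open>The \<open>max 1\<close> reflects that hidden widths must stay positive: the
    last unit of a layer is never deleted.\<close>
  obtain b where b: "\<forall>d. d 0 = CARD('i) \<longrightarrow> d L = CARD('o) \<longrightarrow>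
      (\<forall>l. 0 < l \<and> l < L \<longrightarrow> d l \<le> max 1 (N l (nb (d (l - 1)) (d (l + 1))))) \<longrightarrow> (\<forall>l\<le>L. d l \<le> b)"
    using widths_bounded[OF nb_cases, of "CARD('i)" L "CARD('o)" "\<lambda>l M. max 1 (N l M)"] by blast
  have reduced: "\<exists>d' W'. admissible L CARD('i) CARD('o) d' \<and> (\<forall>l\<le>L. d' l \<le> b) \<and> cost d' W' \<le> cost d W"
    if "admissible L CARD('i) CARD('o) d" "cost d W \<le> C" for d W
    using that
  \<comment> \<open>Each deletion lowers the total width by one. The cost stays at most
    \<open>C\<close>, so the thresholds \<open>N\<close> remain valid for the reduced
    network.\<close>
  proof (induction "\<Sum>l\<le>L. d l" arbitrary: d W rule: less_induct)
    case less
    show ?case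
    proof (cases "\<forall>l. 0 < l \<and> l < L \<longrightarrow> d l \<le> max 1 (N l (nb (d (l - 1)) (d (l + 1))))")
      case True
      then have "\<forall>l\<le>L. d l \<le> b"
        using b less.prems(1) by (simp add: admissible_def)
      then show ?thesis using less.prems(1) by blast
    next
      case False
      then obtain l where l: "0 < l" "l < L" and wide: "1 < d l" "N l (nb (d (l - 1)) (d (l + 1))) < d l"
        by (auto simp: not_le)
      let ?d = "d(l := d l - 1)"
      obtain W' where W': "cost ?d W' \<le> cost d W"
        using N[OF l less.prems(1) total_le_if_cost_le[OF less.prems(2)] order_refl wide(2)] by blast
      have adm: "admissible L CARD('i) CARD('o) ?d"
        using less.prems(1) l wide(1) by (auto simp: admissible_def)
      have "(\<Sum>k\<le>L. ?d k) < (\<Sum>k\<le>L. d k)"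
        using l wide(1) by (intro sum_strict_mono_ex1) auto
      then obtain d' W'' where "admissible L CARD('i) CARD('o) d'" "\<forall>l\<le>L. d' l \<le> b" "cost d' W'' \<le> cost ?d W'"
        using less.hyps[OF _ adm, of W'] W' less.prems(2) by auto
      then show ?thesis
        using W' by (intro exI[of _ d'] exI[of _ W'']) auto
    qed
  qed
  show ?thesis
    by (rule exI[of _ b], intro allI impI, rule reduced)
qed

subsection \<open>Existence of a minimiser\<close>

lemma continuous_on_layer:
  assumes "m \<le> L"
  shows "continuous_on S (\<lambda>W. layer \<sigma> d W x m j)"
  using assms
proof (induction m arbitrary: j)
  case (Suc m)
  have "continuous_on UNIV (\<sigma> (Suc m))"
    using Suc.prems by (intro activation_continuous activation) simp
  moreover have "continuous_on S (\<lambda>W. \<Sum>i<d m. layer \<sigma> d W x m i * W (Suc m) i j)"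
    using Suc by (intro continuous_on_sum continuous_on_mult continuous_on_weight_entry) simp
  ultimately show ?case
    by (auto intro: continuous_on_compose2)
qed simp

lemma continuous_on_cost: "continuous_on S (cost d)"
proof -
  have "continuous_on S (\<lambda>W. net L \<sigma> d W x :: real^'o)" for x :: "real^'i"
    unfolding net_def by (intro continuous_on_vec_lambda continuous_on_layer order_refl)
  then have e: "continuous_on S (\<lambda>W. e (net L \<sigma> d W x) y)" for x :: "real^'i" and y
    using continuous_on_compose2[OF error_continuous[OF error, of UNIV y]] by blast
  have "continuous_on S (\<lambda>W. pen n m (W l))" for n m l
    using continuous_on_compose2[OF continuous_pen continuous_on_weight] by blast
  then have "continuous_on S (total d)"
    unfolding total_def[abs_def] by (intro continuous_on_sum)
  then show ?thesis
    unfolding cost_def[abs_def] case_prod_unfold using e finite_data data_nonempty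
    by (intro continuous_on_add continuous_on_divide continuous_on_sum continuous_on_mult continuous_on_const) auto
qed

lemma min_weights_exist:
  assumes d: "admissible L CARD('i) CARD('o) d"
  shows "\<exists>W. \<forall>W'. cost d W \<le> cost d W'"
proof -
  \<comment> \<open>Weights at least as good as zero have total penalty at most \<open>R\<close>,
    and the penalty dominates every entry within the dimensions.\<close>
  define R where "R = cost d (\<lambda>_ _ _. 0) / lam"
  define box where "box = {W :: nat \<Rightarrow> nat \<Rightarrow> nat \<Rightarrow> real. \<forall>l. W l \<in> {A. \<forall>i. A i \<in> {v. \<forall>j. v j \<in> {- R..R}}}}"
  have R: "0 \<le> R"
    using total_le_if_cost_le[OF order_refl, of d "\<lambda>_ _ _. 0"] total_nonneg[of d "\<lambda>_ _ _. 0"]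
    unfolding R_def by linarith
  have "compact box"
    unfolding box_def by (intro compact_functions_into compact_Icc)
  moreover have zero: "(\<lambda>_ _ _. 0) \<in> box"
    using R by (simp add: box_def)
  ultimately obtain W where W: "W \<in> box" "\<And>W'. W' \<in> box \<Longrightarrow> cost d W \<le> cost d W'"
    using continuous_attains_inf[OF _ _ continuous_on_cost, of box d] by blast
  have "cost d W \<le> cost d W'" for W'
  proof (cases "cost d W' \<le> cost d (\<lambda>_ _ _. 0)")
    case True
    \<comment> \<open>Clamping moves \<open>W'\<close> into the box; the entries within the
      dimensions already lie in \<open>[-R, R]\<close>, so only irrelevant ones change.\<close>
    define V where "V = (\<lambda>l i j. max (- R) (min R (W' l i j)))"
    have "\<bar>W' l i j\<bar> \<le> R" if "l \<in> {1..L}" "i < d (l - 1)" "j < d l" for l i j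
      using entry_le_pen[OF that(2,3), of "W' l"] pen_le_total[OF that(1), of d W'] total_le_if_cost_le[OF True]
      unfolding R_def by linarith
    then have "W' l i j = V l i j" if "l \<in> {1..L}" "i < d (l - 1)" "j < d l" for l i j
      using that unfolding V_def by fastforce
    then have "cost d W' = cost d V"
      using d by (intro cost_cong) (auto simp: admissible_def)
    moreover have "V \<in> box"
      using R by (auto simp: box_def V_def)
    ultimately show ?thesis
      using W(2) by simp
  next
    case False
    then show ?thesis
      using W(2)[OF zero] by linarith
  qed
  then show ?thesis by blast
qed

theorem cost_attains_minimum:
  "\<exists>d W. admissible L CARD('i) CARD('o) d \<and>
     (\<forall>d' W'. admissible L CARD('i) CARD('o) d' \<longrightarrow> cost d W \<le> cost d' W')"
proof -
  \<comment> \<open>The narrowest network, with zero weights, serves as a reference: only networks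
    of at most its cost \<open>?C\<close> have to be reduced, and this level fixes the width bound
    \<open>b\<close>.\<close>
  define d1 where "d1 = (\<lambda>l. if l = 0 then CARD('i) else if l = L then CARD('o) else 1 :: nat)"
  have d1: "admissible L CARD('i) CARD('o) d1"
    using depth by (simp add: admissible_def d1_def)
  let ?C = "cost d1 (\<lambda>_ _ _. 0)"
  obtain b where b: "\<And>d W. admissible L CARD('i) CARD('o) d \<Longrightarrow> cost d W \<le> ?C \<Longrightarrow>
    (\<exists>d' W'. admissible L CARD('i) CARD('o) d' \<and> (\<forall>l\<le>L. d' l \<le> b) \<and> cost d' W' \<le> cost d W)"
    using reducible_to_bounded_width[of ?C] by blast
  \<comment> \<open>Widths beyond layer \<open>L\<close> are set to \<open>0\<close>, as otherwise
    infinitely many width functions would describe the same network shape.\<close>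
  define S where "S = {d. admissible L CARD('i) CARD('o) d \<and> (\<forall>l. l \<in> {..L} \<longrightarrow> d l \<in> {..b}) \<and> (\<forall>l. l \<notin> {..L} \<longrightarrow> d l = 0)}"
  have S: "\<exists>d'\<in>S. \<exists>W'. cost d' W' \<le> cost d W"
    if adm: "admissible L CARD('i) CARD('o) d" "cost d W \<le> ?C" for d W
  proof -
    obtain d' W' where *: "admissible L CARD('i) CARD('o) d'" "\<forall>l\<le>L. d' l \<le> b" "cost d' W' \<le> cost d W"
      using b[OF adm] by blast
    define d'' where "d'' = (\<lambda>l. if l \<le> L then d' l else 0)"
    have "cost d' W' = cost d'' W'"
      using *(1) by (intro cost_cong) (auto simp: d''_def admissible_def)
    moreover have "d'' \<in> S"
      using * by (auto simp: S_def d''_def admissible_def)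
    ultimately show ?thesis using *(3) by (intro bexI[of _ d''] exI[of _ W']) simp_all
  qed
  have "finite S"
    using finite_set_of_finite_funs[of "{..L}" "{..b}" 0]
    by (rule finite_subset[rotated]) (auto simp: S_def)
  have "\<forall>d. \<exists>W. admissible L CARD('i) CARD('o) d \<longrightarrow> (\<forall>W'. cost d W \<le> cost d W')"
    using min_weights_exist by blast
  then obtain V where "\<forall>d. admissible L CARD('i) CARD('o) d \<longrightarrow> (\<forall>W'. cost d (V d) \<le> cost d W')"
    by (rule choice[THEN exE])
  then have V: "cost d (V d) \<le> cost d W'" if "admissible L CARD('i) CARD('o) d" for d W'
    using that by simp
  have "S \<noteq> {}"
    using S[OF d1 order_refl] by blast
  then obtain d where d: "d \<in> S" "\<And>d'. d' \<in> S \<Longrightarrow> cost d (V d) \<le> cost d' (V d')"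
    using ex_is_arg_min_if_finite[OF \<open>finite S\<close>, of "\<lambda>d. cost d (V d)"] by (auto simp: is_arg_min_linorder)
  have min: "cost d (V d) \<le> cost d' W'" if adm: "admissible L CARD('i) CARD('o) d'" "cost d' W' \<le> ?C" for d' W'
  proof -
    obtain d'' W'' where *: "d'' \<in> S" "cost d'' W'' \<le> cost d' W'"
      using S[OF adm] by blast
    have "cost d (V d) \<le> cost d'' (V d'')"
      using d(2) *(1) .
    also have "\<dots> \<le> cost d'' W''"
      using *(1) by (intro V) (simp add: S_def)
    finally show ?thesis using *(2) by linarith
  qed
  \<comment> \<open>A network above the level \<open>?C\<close> is compared with the reference
    network instead.\<close>
  have "cost d (V d) \<le> cost d' W'" if "admissible L CARD('i) CARD('o) d'" for d' W'
    using min[OF that, of W'] min[OF d1 order_refl] by linarith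
  then show ?thesis
    using d(1) by (auto simp: S_def)
qed

end

theorem theorem1:
  fixes L :: nat
    and D :: "((real^'i::finite) \<times> 'y) set"
    and \<sigma> :: "nat \<Rightarrow> real \<Rightarrow> real"
    and e :: "real^'o::finite \<Rightarrow> 'y \<Rightarrow> real"
    and lam p :: real
    and \<Omega> :: "nat \<Rightarrow> (nat \<Rightarrow> nat) \<Rightarrow> (nat \<Rightarrow> nat \<Rightarrow> nat \<Rightarrow> real) \<Rightarrow> real \<Rightarrow> real \<Rightarrow> real"
  assumes "1 \<le> L"
    and "finite D" and "D \<noteq> {}"
    and "\<forall>l\<in>{1..L}. activation_ok (\<sigma> l)"
    and "error_ok e"
    and "0 < lam" and "1 \<le> p"
    and "\<Omega> = Omega_in \<or> \<Omega> = Omega_out"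
  shows "\<exists>d W. admissible L CARD('i) CARD('o) d \<and>
           (\<forall>d' W'. admissible L CARD('i) CARD('o) d' \<longrightarrow>
              energy L \<sigma> e D lam p \<Omega> d W \<le> energy L \<sigma> e D lam p \<Omega> d' W')"
  using assms(8)
proof
  assume \<Omega>: "\<Omega> = Omega_in"
  interpret layer_penalty "\<lambda>n v. \<Sum>i<n. \<bar>v i\<bar>" "col_pen p" "\<lambda>n r. r"
    using assms(7) by (rule layer_penalty_in)
  interpret penalised_network "\<lambda>n v. \<Sum>i<n. \<bar>v i\<bar>" "col_pen p" "\<lambda>n r. r" L D \<sigma> e lam
    using assms by unfold_locales auto
  have "cost = energy L \<sigma> e D lam p \<Omega>"
    unfolding \<Omega> by (intro ext) (simp only: cost_def energy_def total_def Omega_in_def col_pen_def)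
  then show ?thesis
    using cost_attains_minimum by simp
next
  assume \<Omega>: "\<Omega> = Omega_out"
  interpret layer_penalty max_nrm "\<lambda>n m A. col_pen p m n (\<lambda>j i. A i j)" "\<lambda>n r. n"
    using assms(7) by (rule layer_penalty_out)
  interpret penalised_network max_nrm "\<lambda>n m A. col_pen p m n (\<lambda>j i. A i j)" "\<lambda>n r. n" L D \<sigma> e lam
    using assms by unfold_locales auto
  have "cost = energy L \<sigma> e D lam p \<Omega>"
    unfolding \<Omega>
    by (intro ext, unfold cost_def, unfold total_def, unfold energy_def Omega_out_def col_pen_def, rule refl)
  then show ?thesis
    using cost_attains_minimum by simp
qed

end
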